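(* Assume $\lambda_1^2+\lambda_4^2=\lambda_2^2+\lambda_3^2$. Let $c_1>|c_2|$ and let $a=\frac{1}{\sqrt2}(\sqrt{c_1+c_2}+\sqrt{c_1-c_2})$, $b=\frac{1}{\sqrt2}(\sqrt{c_1+c_2}-\sqrt{c_1-c_2})$. Let $\alpha_1$ be the smaller of the two (real, strictly positive, distinct) roots of $$\widetilde f(t)=(\lambda_1^2-\lambda_4^2)^2t^2-2\left[(\lambda_1^2-\lambda_2^2)(\lambda_3^2-\lambda_4^2)+(\lambda_1^2-\lambda_3^2)(\lambda_2^2-\lambda_4^2)\right]t+(\lambda_2^2-\lambda_3^2)^2 ,$$ the larger root being $1$. Consider the equilibria $M^1_{b,a},\,M^1_{-b,-a}\in\mathfrak{t}_1\cap\operatorname{Orb}_{c_1;c_2}$ of the $\mathfrak{so}(4)$ rigid body equations. Then: (i) If $\frac{b^2}{a^2}\in[0,\alpha_1)$, they are non-degenerate, unstable of saddle-saddle type. (ii) If $\frac{b^2}{a^2}\in(\alpha_1,1)$, they are non-degenerate, unstable of focus-focus type. (iii) If $\frac{b^2}{a^2}=\alpha_1$, they are degenerate and unstable. Thus these equilibria are also unstable for the Lie-Poisson dynamics on $\mathfrak{so}(4)$.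
   Context: Let $\lambda_1>\lambda_2>\lambda_3>\lambda_4$ be real numbers with $\lambda_i+\lambda_j>0$ for $i\ne j$, and $J=\operatorname{diag}(\lambda_1,\lambda_2,\lambda_3,\lambda_4)$. The Lie-Poisson dynamics of the $\mathfrak{so}(4)$ rigid body is $\dot M=[M,\Omega]$ on $\mathfrak{so}(4)$ (real antisymmetric $4\times4$ matrices), where $\Omega\in\mathfrak{so}(4)$ is determined by $M=J\Omega+\Omega J$. Write $$M=\begin{bmatrix}0&-x_3&x_2&y_1\\ x_3&0&-x_1&y_2\\ -x_2&x_1&0&y_3\\ -y_1&-y_2&-y_3&0\end{bmatrix}.$$ The following are constants of motion: $C_1=\frac12(\sum x_i^2+\sum y_i^2)$, $C_2=\sum x_iy_i$ (Casimirs), $$H=\tfrac12\left(\tfrac{x_1^2}{\lambda_2+\lambda_3}+\tfrac{x_2^2}{\lambda_1+\lambda_3}+\tfrac{x_3^2}{\lambda_1+\lambda_2}+\tfrac{y_1^2}{\lambda_1+\lambda_4}+\tfrac{y_2^2}{\lambda_2+\lambda_4}+\tfrac{y_3^2}{\lambda_3+\lambda_4}\right),$$ $$I=(\lambda_2^2+\lambda_3^2)x_1^2+(\lambda_1^2+\lambda_3^2)x_2^2+(\lambda_1^2+\lambda_2^2)x_3^2+(\lambda_1^2+\lambda_4^2)y_1^2+(\lambda_2^2+\lambda_4^2)y_2^2+(\lambda_3^2+\lambda_4^2)y_3^2.$$ For $c_1>|c_2|$, $\operatorname{Orb}_{c_1;c_2}=\{M\mid C_1(M)=c_1,\,C_2(M)=c_2\}$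 is a four-dimensional regular adjoint orbit of $\operatorname{SO}(4)$, invariant under the dynamics, with orbit symplectic form $\omega$, $\omega(M)([M,X],[M,Y])=\frac12\operatorname{Trace}(M[X,Y])$. For a function $F$ on $\mathfrak{so}(4)$, the Hamiltonian vector field of $F|_{\operatorname{Orb}_{c_1;c_2}}$ is $X_{F|_{\operatorname{Orb}_{c_1;c_2}}}(M)=[M,\nabla F(M)]$, with the gradient taken relative to $\langle X,Y\rangle=-\frac12\operatorname{Trace}(XY)$; for $F=H$ this is the restriction of the rigid body equation. $M^1_{p,q}$ is the matrix with $x_1=p$, $y_1=q$, $x_2=x_3=y_2=y_3=0$, and $\mathfrak{t}_1=\{M^1_{p,q}\mid p,q\in\mathbb{R}\}$. An equilibrium $M\in\operatorname{Orb}_{c_1;c_2}$ at which the differentials of both $H|_{\operatorname{Orb}_{c_1;c_2}}$ and $I|_{\operatorname{Orb}_{c_1;c_2}}$ vanish is called non-degenerate if the (commuting) linearizations $\mathbf{D}X_{H|_{\operatorname{Orb}_{c_1;c_2}}}(M)$ and $\mathbf{D}X_{I|_{\operatorname{Orb}_{c_1;c_2}}}(M)$ generate a Cartan subalgebra of the Lie algebra of infinitesimally symplectic linear maps of $(T_M\operatorname{Orb}_{c_1;c_2},\omega(M))$, and degenerate otherwise. A non-degenerate equilibrium is of saddle-saddle, respectively focus-focus type if this Cartan subalgebra is conjugate to the algebra of matrices (with $A,B$ ranging over $\mathbb{R}$) $$\begin{bmatrix} -A&0&0&0 \\ 0&-B&0&0 \\ 0&0&A&0 \\ 0&0&0&B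 \end{bmatrix},\qquad\begin{bmatrix} -A&-B&0&0 \\ B&-A&0&0 \\ 0&0&A&-B \\ 0&0&B&A \end{bmatrix},$$ respectively (eigenvalues $\pm A,\pm B$; $\pm A\pm iB$). Unstable means not Lyapunov stable; in (i)–(iii) this refers to the dynamics restricted to $\operatorname{Orb}_{c_1;c_2}$. *)

theory Defs
  imports "HOL-Analysis.Analysis"
begin

type_synonym mat4 = "real^4^4"

definition lie :: "mat4 \<Rightarrow> mat4 \<Rightarrow> mat4" where
  "lie X Y = X ** Y - Y ** X"

definition so4 :: "mat4 set" where
  "so4 = {M. transpose M = - M}"

definition ip :: "mat4 \<Rightarrow> mat4 \<Rightarrow> real" where
  "ip X Y = - (1/2) * trace (X ** Y)"

definition so4_mat :: "real^3 \<Rightarrow> real^3 \<Rightarrow> mat4" where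
  "so4_mat x y = vector
    [vector [0, - x$3, x$2, y$1],
     vector [x$3, 0, - x$1, y$2],
     vector [- x$2, x$1, 0, y$3],
     vector [- y$1, - y$2, - y$3, 0]]"

definition xc :: "mat4 \<Rightarrow> real^3" where
  "xc M = vector [M$3$2, M$1$3, M$2$1]"

definition yc :: "mat4 \<Rightarrow> real^3" where
  "yc M = vector [M$1$4, M$2$4, M$3$4]"

lemma so4_mat_nth:
  "so4_mat x y $ 1 $ 1 = 0" "so4_mat x y $ 1 $ 2 = - x$3" "so4_mat x y $ 1 $ 3 = x$2" "so4_mat x y $ 1 $ 4 = y$1"
  "so4_mat x y $ 2 $ 1 = x$3" "so4_mat x y $ 2 $ 2 = 0" "so4_mat x y $ 2 $ 3 = - x$1" "so4_mat x y $ 2 $ 4 = y$2"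
  "so4_mat x y $ 3 $ 1 = - x$2" "so4_mat x y $ 3 $ 2 = x$1" "so4_mat x y $ 3 $ 3 = 0" "so4_mat x y $ 3 $ 4 = y$3"
  "so4_mat x y $ 4 $ 1 = - y$1" "so4_mat x y $ 4 $ 2 = - y$2" "so4_mat x y $ 4 $ 3 = - y$3" "so4_mat x y $ 4 $ 4 = 0"
  by (simp_all add: so4_mat_def vector_def)

lemma xc_so4_mat: "xc (so4_mat x y) = x"
  by (simp add: vec_eq_iff forall_3 xc_def vector_3 so4_mat_nth)

lemma yc_so4_mat: "yc (so4_mat x y) = y"
  by (simp add: vec_eq_iff forall_3 yc_def vector_3 so4_mat_nth)

definition J_mat :: "real^4 \<Rightarrow> mat4" where
  "J_mat lam = (\<chi> i j. if i = j then lam$i else 0)"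

definition Omega :: "real^4 \<Rightarrow> mat4 \<Rightarrow> mat4" where
  "Omega lam M = (THE W. W \<in> so4 \<and> M = J_mat lam ** W + W ** J_mat lam)"

definition rigid_body :: "real^4 \<Rightarrow> mat4 \<Rightarrow> mat4" where
  "rigid_body lam M = lie M (Omega lam M)"

definition C1 :: "mat4 \<Rightarrow> real" where
  "C1 M = 1/2 * ((\<Sum>i\<in>UNIV. (xc M $ i)\<^sup>2) + (\<Sum>i\<in>UNIV. (yc M $ i)\<^sup>2))"

definition C2 :: "mat4 \<Rightarrow> real" where
  "C2 M = (\<Sum>i\<in>UNIV. xc M $ i * yc M $ i)"

definition H_fun :: "real^4 \<Rightarrow> mat4 \<Rightarrow> real" where
  "H_fun lam M = 1/2 *
    ((xc M $ 1)\<^sup>2 / (lam$2 + lam$3) + (xc M $ 2)\<^sup>2 / (lam$1 + lam$3) + (xc M $ 3)\<^sup>2 / (lam$1 + lam$2)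
   + (yc M $ 1)\<^sup>2 / (lam$1 + lam$4) + (yc M $ 2)\<^sup>2 / (lam$2 + lam$4) + (yc M $ 3)\<^sup>2 / (lam$3 + lam$4))"

definition I_fun :: "real^4 \<Rightarrow> mat4 \<Rightarrow> real" where
  "I_fun lam M =
     ((lam$2)\<^sup>2 + (lam$3)\<^sup>2) * (xc M $ 1)\<^sup>2 + ((lam$1)\<^sup>2 + (lam$3)\<^sup>2) * (xc M $ 2)\<^sup>2
   + ((lam$1)\<^sup>2 + (lam$2)\<^sup>2) * (xc M $ 3)\<^sup>2 + ((lam$1)\<^sup>2 + (lam$4)\<^sup>2) * (yc M $ 1)\<^sup>2
   + ((lam$2)\<^sup>2 + (lam$4)\<^sup>2) * (yc M $ 2)\<^sup>2 + ((lam$3)\<^sup>2 + (lam$4)\<^sup>2) * (yc M $ 3)\<^sup>2"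

definition Orb :: "real \<Rightarrow> real \<Rightarrow> mat4 set" where
  "Orb c1 c2 = {M \<in> so4. C1 M = c1 \<and> C2 M = c2}"

definition tangent :: "mat4 \<Rightarrow> mat4 set" where
  "tangent M = {lie M X | X. X \<in> so4}"

text \<open>Well defined for \<open>u, v\<close> in \<open>tangent M\<close>: the value does not depend on the choice of
  \<open>X\<close> and \<open>Y\<close>.\<close>

definition orb_form :: "mat4 \<Rightarrow> mat4 \<Rightarrow> mat4 \<Rightarrow> real" where
  "orb_form M u v = (THE r. \<exists>X\<in>so4. \<exists>Y\<in>so4.
      u = lie M X \<and> v = lie M Y \<and> r = 1/2 * trace (M ** lie X Y))"

text \<open>A derivative within the linear subspace \<open>so4\<close> is determined on \<open>so4\<close> only, which makes the
  gradient unique; values of \<open>F\<close> off \<open>so4\<close> are irrelevant.\<close>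

definition grad :: "(mat4 \<Rightarrow> real) \<Rightarrow> mat4 \<Rightarrow> mat4" where
  "grad F M = (THE G. G \<in> so4 \<and> (F has_derivative ip G) (at M within so4))"

definition ham_field :: "(mat4 \<Rightarrow> real) \<Rightarrow> mat4 \<Rightarrow> mat4" where
  "ham_field F M = lie M (grad F M)"

text \<open>The differential of the restriction of \<open>F\<close> to the orbit through \<open>M\<close> is the
  restriction to the tangent space of the differential of \<open>F\<close> on \<open>so4\<close>.\<close>

definition critical_on_orbit :: "(mat4 \<Rightarrow> real) \<Rightarrow> mat4 \<Rightarrow> bool" where
  "critical_on_orbit F M \<longleftrightarrow>
     (\<exists>D. (F has_derivative D) (at M within so4) \<and> (\<forall>v\<in>tangent M. D v = 0))"

type_synonym endo = "mat4 \<Rightarrow>\<^sub>L mat4"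

text \<open>A linear endomorphism of the subspace \<open>T\<close> is encoded as the endomorphism of the ambient
  space extending it by \<open>0\<close> on the orthogonal complement of \<open>T\<close>. This is an isomorphism of
  Lie algebras from \<open>End T\<close> onto \<open>endos T\<close>.\<close>

definition endos :: "mat4 set \<Rightarrow> endo set" where
  "endos T = {A. (\<forall>v. blinfun_apply A v \<in> T) \<and> (\<forall>v. (\<forall>w\<in>T. v \<bullet> w = 0) \<longrightarrow> blinfun_apply A v = 0)}"

definition comm :: "endo \<Rightarrow> endo \<Rightarrow> endo" where
  "comm A B = (A o\<^sub>L B) - (B o\<^sub>L A)"

definition sp :: "mat4 set \<Rightarrow> (mat4 \<Rightarrow> mat4 \<Rightarrow> real) \<Rightarrow> endo set" where
  "sp T \<omega> = {A \<in> endos T.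
     \<forall>u\<in>T. \<forall>v\<in>T. \<omega> (blinfun_apply A u) v + \<omega> u (blinfun_apply A v) = 0}"

definition lie_subalgebra :: "endo set \<Rightarrow> endo set \<Rightarrow> bool" where
  "lie_subalgebra g h \<longleftrightarrow> subspace h \<and> h \<subseteq> g \<and> (\<forall>A\<in>h. \<forall>B\<in>h. comm A B \<in> h)"

fun lower_central :: "endo set \<Rightarrow> nat \<Rightarrow> endo set" where
  "lower_central h 0 = h"
| "lower_central h (Suc n) = span {comm A B | A B. A \<in> h \<and> B \<in> lower_central h n}"

definition cartan_subalgebra :: "endo set \<Rightarrow> endo set \<Rightarrow> bool" where
  "cartan_subalgebra g h \<longleftrightarrow>
     lie_subalgebra g h \<and>
     (\<exists>n. lower_central h n = {0}) \<and>
     {A \<in> g. \<forall>B\<in>h. comm A B \<in> h} = h"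

definition lie_generated :: "endo set \<Rightarrow> endo set \<Rightarrow> endo set" where
  "lie_generated g S = lie_subalgebra g hull S"

text \<open>The vector field is tangent to the orbits, so at an equilibrium its derivative maps the tangent
  space of the orbit to itself; the linearization on the orbit is this restriction.\<close>

definition linearization :: "(mat4 \<Rightarrow> real) \<Rightarrow> mat4 \<Rightarrow> endo" where
  "linearization F M = (THE A. A \<in> endos (tangent M) \<and>
     (\<exists>D. (ham_field F has_derivative D) (at M within so4) \<and>
          (\<forall>v\<in>tangent M. blinfun_apply A v = D v)))"

definition sp_orb :: "mat4 \<Rightarrow> endo set" where
  "sp_orb M = sp (tangent M) (orb_form M)"

definition lin_algebra :: "real^4 \<Rightarrow> mat4 \<Rightarrow> endo set" where
  "lin_algebra lam M =
     lie_generated (sp_orb M) {linearization (H_fun lam) M, linearization (I_fun lam) M}"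

definition singular_equilibrium :: "real^4 \<Rightarrow> real \<Rightarrow> real \<Rightarrow> mat4 \<Rightarrow> bool" where
  "singular_equilibrium lam c1 c2 M \<longleftrightarrow>
     M \<in> Orb c1 c2 \<and> rigid_body lam M = 0 \<and>
     critical_on_orbit (H_fun lam) M \<and> critical_on_orbit (I_fun lam) M"

definition nondegenerate :: "real^4 \<Rightarrow> real \<Rightarrow> real \<Rightarrow> mat4 \<Rightarrow> bool" where
  "nondegenerate lam c1 c2 M \<longleftrightarrow>
     singular_equilibrium lam c1 c2 M \<and> cartan_subalgebra (sp_orb M) (lin_algebra lam M)"

definition degenerate :: "real^4 \<Rightarrow> real \<Rightarrow> real \<Rightarrow> mat4 \<Rightarrow> bool" where
  "degenerate lam c1 c2 M \<longleftrightarrow>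
     singular_equilibrium lam c1 c2 M \<and> \<not> cartan_subalgebra (sp_orb M) (lin_algebra lam M)"

definition std_form :: "real^4 \<Rightarrow> real^4 \<Rightarrow> real" where
  "std_form u v = u$1 * v$3 - u$3 * v$1 + u$2 * v$4 - u$4 * v$2"

text \<open>Conjugacy of a set of endomorphisms of \<open>(T, \<omega>)\<close> with a set of matrices by a linear
  symplectomorphism \<open>\<phi>\<close> from the standard symplectic space. The sign of \<^const>\<open>std_form\<close> does not
  matter for the two matrix algebras below: the map \<open>diag (-1, -1, 1, 1)\<close> reverses it and commutes
  with both of them.\<close>

definition conjugate_to :: "mat4 set \<Rightarrow> (mat4 \<Rightarrow> mat4 \<Rightarrow> real) \<Rightarrow> endo set \<Rightarrow> mat4 set \<Rightarrow> bool" where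
  "conjugate_to T \<omega> h K \<longleftrightarrow>
     (\<exists>\<phi> :: real^4 \<Rightarrow> mat4. linear \<phi> \<and> bij_betw \<phi> UNIV T \<and>
        (\<forall>u v. \<omega> (\<phi> u) (\<phi> v) = std_form u v) \<and>
        h = {A \<in> endos T. \<exists>B\<in>K. \<forall>u. blinfun_apply A (\<phi> u) = \<phi> (B *v u)})"

definition saddle_saddle_mats :: "mat4 set" where
  "saddle_saddle_mats = {vector
     [vector [- A, 0, 0, 0],
      vector [0, - B, 0, 0],
      vector [0, 0, A, 0],
      vector [0, 0, 0, B]] | A B. True}"

definition focus_focus_mats :: "mat4 set" where
  "focus_focus_mats = {vector
     [vector [- A, - B, 0, 0],
      vector [B, - A, 0, 0],
      vector [0, 0, A, - B],
      vector [0, 0, B, A]] | A B. True}"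

definition saddle_saddle :: "real^4 \<Rightarrow> real \<Rightarrow> real \<Rightarrow> mat4 \<Rightarrow> bool" where
  "saddle_saddle lam c1 c2 M \<longleftrightarrow> nondegenerate lam c1 c2 M \<and>
     conjugate_to (tangent M) (orb_form M) (lin_algebra lam M) saddle_saddle_mats"

definition focus_focus :: "real^4 \<Rightarrow> real \<Rightarrow> real \<Rightarrow> mat4 \<Rightarrow> bool" where
  "focus_focus lam c1 c2 M \<longleftrightarrow> nondegenerate lam c1 c2 M \<and>
     conjugate_to (tangent M) (orb_form M) (lin_algebra lam M) focus_focus_mats"

definition solution_in :: "mat4 set \<Rightarrow> (mat4 \<Rightarrow> mat4) \<Rightarrow> (real \<Rightarrow> mat4) \<Rightarrow> bool" where
  "solution_in S X \<gamma> \<longleftrightarrow>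
     (\<forall>t\<ge>0. \<gamma> t \<in> S \<and> (\<gamma> has_vector_derivative X (\<gamma> t)) (at t within {0..}))"

definition lyapunov_stable_in :: "mat4 set \<Rightarrow> (mat4 \<Rightarrow> mat4) \<Rightarrow> mat4 \<Rightarrow> bool" where
  "lyapunov_stable_in S X M \<longleftrightarrow>
     (\<forall>\<epsilon>>0. \<exists>\<delta>>0. \<forall>\<gamma>. solution_in S X \<gamma> \<and> dist (\<gamma> 0) M < \<delta> \<longrightarrow> (\<forall>t\<ge>0. dist (\<gamma> t) M < \<epsilon>))"

abbreviation unstable_in :: "mat4 set \<Rightarrow> (mat4 \<Rightarrow> mat4) \<Rightarrow> mat4 \<Rightarrow> bool" where
  "unstable_in S X M \<equiv> \<not> lyapunov_stable_in S X M"

definition M1 :: "real \<Rightarrow> real \<Rightarrow> mat4" where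
  "M1 p q = so4_mat (vector [p, 0, 0]) (vector [q, 0, 0])"

definition t1 :: "mat4 set" where
  "t1 = {M1 p q | p q. True}"

definition f_tilde :: "real^4 \<Rightarrow> real \<Rightarrow> real" where
  "f_tilde lam t = ((lam$1)\<^sup>2 - (lam$4)\<^sup>2)\<^sup>2 * t\<^sup>2
     - 2 * (((lam$1)\<^sup>2 - (lam$2)\<^sup>2) * ((lam$3)\<^sup>2 - (lam$4)\<^sup>2)
          + ((lam$1)\<^sup>2 - (lam$3)\<^sup>2) * ((lam$2)\<^sup>2 - (lam$4)\<^sup>2)) * t
     + ((lam$2)\<^sup>2 - (lam$3)\<^sup>2)\<^sup>2"

definition alpha1 :: "real^4 \<Rightarrow> real" where
  "alpha1 lam = Min {t. f_tilde lam t = 0}"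

end

theory Submission
  imports Defs
begin

text \<open>A matrix of \<open>so4\<close> is a pair \<open>(x, y)\<close> of vectors of \<open>\<real>\<^sup>3\<close>, with bracket
\<open>[(x, y), (x', y')] = (x \<times> x' + y \<times> y', x \<times> y' + y \<times> x')\<close>. At \<open>M1 p q\<close> with \<open>p\<^sup>2 < q\<^sup>2\<close> the tangent space
of the orbit is the space \<open>x\<^sub>1 = y\<^sub>1 = 0\<close>, with coordinates \<open>\<xi> = (x\<^sub>2, y\<^sub>2)\<close> and \<open>\<eta> = (x\<^sub>3, y\<^sub>3)\<close>, and the
linearization of a diagonal quadratic Hamiltonian exchanges \<open>\<xi>\<close> and \<open>\<eta>\<close>.

Under the resonance, the quadratic terms of \<open>I\<close> in \<open>x\<^sub>1\<close> and \<open>y\<^sub>1\<close> have the same coefficient, so up to a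
multiple of the Casimir \<open>C1\<close> the integral \<open>I\<close> is quadratic in \<open>\<xi>\<close> and \<open>\<eta>\<close>. Its linearization is
\<open>\<xi>' = - 2 m T \<eta>, \<eta>' = 2 n T \<xi>\<close> with \<open>T = [[p, - q], [q, - p]]\<close>, \<open>m = \<lambda>\<^sub>1\<^sup>2 - \<lambda>\<^sub>3\<^sup>2\<close>, \<open>n = \<lambda>\<^sub>1\<^sup>2 - \<lambda>\<^sub>2\<^sup>2\<close>. Since
\<open>T\<^sup>2 = (p\<^sup>2 - q\<^sup>2) Id\<close> is negative, this map has exactly two eigenvalues, real and opposite, and its
eigenspaces are the two Lagrangian planes \<open>\<eta> = \<plusminus> \<rho> T \<xi>\<close>. The linearization of \<open>H\<close> commutes with
it, hence preserves both planes; on the first one it is \<open>\<rho> m N\<close> with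
\<open>N = [[g, f], [- f, h]]\<close>, and on the second one it is determined by duality. In a symplectic frame adapted
to the two planes, the algebra generated by the linearizations therefore consists of the block
matrices \<open>diag(X, - X\<^sup>T)\<close> with \<open>X\<close> in the span of \<open>N\<close> and the identity (\<open>resonant_linearization_algebra\<close>).

So everything depends on the discriminant \<open>(g - h)\<^sup>2 - 4 f\<^sup>2\<close> of \<open>N\<close>, which is a positive multiple of
\<open>\<alpha>\<^sub>1 - p\<^sup>2 / q\<^sup>2\<close> (\<open>resonant_discriminant\<close>). If \<open>N\<close> has distinct real eigenvalues, or a pair of
non-real ones, the span of \<open>N\<close> and the identity is its own normalizer in \<open>gl(2)\<close>, which gives a
Cartan subalgebra of saddle-saddle or focus-focus type. If \<open>N\<close> is a Jordan block, the normalizer is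
strictly larger and the equilibrium is degenerate (\<open>resonant_type\<close>).

Instability has one proof for the three cases. The trace of \<open>N\<close> is negative and its determinant
is positive, so \<open>S = det N Id + adj(N)\<^sup>T adj(N)\<close> is positive definite and satisfies
\<open>N\<^sup>T S + S N = 2 tr N det N Id\<close>. As a consequence the form \<open>\<xi>\<^sup>T S T \<eta>\<close> has a positive definite derivative along
the linear flow (\<open>lyap_form_growth\<close>). The exact equations for \<open>\<xi>\<close> and \<open>\<eta>\<close> are those of the linear flow with
\<open>(p, q)\<close> replaced by the current values of \<open>(x\<^sub>1, y\<^sub>1)\<close>, so the form also grows along every solution that
stays close to the equilibrium. It takes positive values on the orbit arbitrarily close to the equilibrium,
and solutions starting there exist for all times since the field is quadratic and preserves the
norm (\<open>quadratic_ode_global_solution\<close>); such solutions must leave a fixed neighbourhood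
(\<open>chetaev_instability\<close>).\<close>

section \<open>Global solutions of quadratic vector fields\<close>

lemma norm_integral_le_exp:
  fixes g :: "real \<Rightarrow> 'a::banach"
  assumes "continuous_on {0..s} g" "\<And>r. r \<in> {0..s} \<Longrightarrow> norm (g r) \<le> c * exp (k * r)"
    and "0 \<le> s" "0 < k" "0 \<le> c"
  shows "norm (integral {0..s} g) \<le> c / k * exp (k * s)"
proof -
  have "((\<lambda>r. c * exp (k * r)) has_integral c / k * exp (k * s) - c / k * exp (k * 0)) {0..s}"
    using assms
    by (intro fundamental_theorem_of_calculus)
       (auto simp: has_real_derivative_iff_has_vector_derivative[symmetric]
          intro!: derivative_eq_intros)
  moreover from this have "norm (integral {0..s} g) \<le> integral {0..s} (\<lambda>r. c * exp (k * r))"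
    using assms
    by (intro integral_norm_bound_integral integrable_continuous_interval) (auto intro!: continuous_intros)
  ultimately have "norm (integral {0..s} g) \<le> c / k * exp (k * s) - c / k * exp (k * 0)"
    by (simp only: integral_unique)
  also have "\<dots> \<le> c / k * exp (k * s)"
    using assms by simp
  finally show ?thesis .
qed

lemma indefinite_integral_has_vector_derivative:
  fixes g :: "real \<Rightarrow> 'a::banach"
  assumes "continuous_on {0..} g" "0 \<le> t"
  shows "((\<lambda>u. integral {0..u} g) has_vector_derivative g t) (at t within {0..})"
proof -
  have "((\<lambda>u. integral {0..u} g) has_vector_derivative g t) (at t within {0..t + 1})"
    using assms by (intro integral_has_vector_derivative) (auto intro: continuous_on_subset)
  moreover have "at t within {0..t + 1} = at t within {0..}"
    using assms by (intro at_within_nhd[where S = "{t - 1<..<t + 1}"]) auto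
  ultimately show ?thesis by simp
qed

text \<open>The Picard operator is a contraction on all of \<open>[0, \<infinity>)\<close> at once if solutions are measured in the
weighted supremum norm of \<open>exp (- 2 K t) \<gamma>(t)\<close>. The unknown \<open>\<phi>\<close> below is this weighted function; it is
extended by a constant to negative times, so that it is a bounded continuous function on the whole line.\<close>

theorem lipschitz_ode_global_solution:
  fixes f :: "'a::banach \<Rightarrow> 'a"
  assumes lip: "\<And>x y. norm (f x - f y) \<le> L * norm (x - y)"
  obtains \<gamma> where "\<gamma> 0 = x0"
    "\<And>t. 0 \<le> t \<Longrightarrow> (\<gamma> has_vector_derivative f (\<gamma> t)) (at t within {0..})"
proof -
  \<comment> \<open>The weight \<open>exp (- 2 K t)\<close> has to decay, so a positive Lipschitz constant is used.\<close>
  define K where "K = max L 1"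
  have K: "0 < K" "L \<le> K" by (auto simp: K_def)
  have lipK: "norm (f x - f y) \<le> K * norm (x - y)" for x y
    using lip[of x y] K(2) by (meson mult_right_mono norm_ge_zero order_trans)
  have contf: "continuous_on UNIV f"
  proof (rule lipschitz_on_continuous_on[of K])
    show "K-lipschitz_on UNIV f"
      using K lipK by (intro lipschitz_onI) (auto simp: dist_norm)
  qed
  have growth: "norm (f x) \<le> norm (f 0) + K * norm x" for x
    using lipK[of x 0] norm_triangle_sub[of "f x" "f 0"] by simp
  define g where "g \<phi> r = f (exp (2 * K * r) *\<^sub>R apply_bcontfun \<phi> r)" for \<phi> :: "real \<Rightarrow>\<^sub>C 'a" and r
  have contg: "continuous_on S (g \<phi>)" for S \<phi>
    unfolding g_def
    by (intro continuous_on_compose2[OF contf] continuous_intros) auto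
  define P where "P \<phi> s = exp (- (2 * K * s)) *\<^sub>R (x0 + integral {0..s} (g \<phi>))" for \<phi> s
  have contP: "continuous_on {0..} (P \<phi>)" for \<phi>
  proof -
    have "continuous_on {0..} (\<lambda>s. integral {0..s} (g \<phi>))"
      using indefinite_integral_has_vector_derivative[OF contg]
      by (force simp: continuous_on_eq_continuous_within intro: has_vector_derivative_continuous)
    then show ?thesis
      unfolding P_def by (intro continuous_intros) auto
  qed
  have bdd: "norm (P \<phi> s) \<le> norm x0 + (norm (f 0) + K * norm \<phi>) / (2 * K)" if "0 \<le> s" for \<phi> s
  proof -
    have "norm (integral {0..s} (g \<phi>)) \<le> (norm (f 0) + K * norm \<phi>) / (2 * K) * exp (2 * K * s)"
    proof (rule norm_integral_le_exp)
      fix r assume r: "r \<in> {0..s}"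
      then have "1 \<le> exp (2 * K * r)" using K by simp
      then have "norm (f 0) \<le> norm (f 0) * exp (2 * K * r)"
        using mult_left_mono[of 1 _ "norm (f 0)"] by simp
      moreover have "K * (exp (2 * K * r) * norm (\<phi> r)) \<le> K * (exp (2 * K * r) * norm \<phi>)"
        using K by (intro mult_left_mono norm_bounded) auto
      ultimately show "norm (g \<phi> r) \<le> (norm (f 0) + K * norm \<phi>) * exp (2 * K * r)"
        using growth[of "exp (2 * K * r) *\<^sub>R \<phi> r"] by (simp add: g_def algebra_simps)
    qed (use K that contg in auto)
    then have "exp (- (2 * K * s)) * norm (integral {0..s} (g \<phi>))
        \<le> exp (- (2 * K * s)) * ((norm (f 0) + K * norm \<phi>) / (2 * K) * exp (2 * K * s))"
      by (intro mult_left_mono) auto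
    also have "\<dots> = (norm (f 0) + K * norm \<phi>) / (2 * K)"
      by (simp add: exp_minus)
    finally have 1: "exp (- (2 * K * s)) * norm (integral {0..s} (g \<phi>)) \<le> \<dots>" .
    have "exp (- (2 * K * s)) * norm x0 \<le> norm x0"
      using K that by (intro mult_left_le_one_le) auto
    moreover have "norm (P \<phi> s)
        \<le> exp (- (2 * K * s)) * (norm x0 + norm (integral {0..s} (g \<phi>)))"
      unfolding P_def norm_scaleR abs_exp_cancel
      by (intro mult_left_mono norm_triangle_ineq) auto
    ultimately show ?thesis
      using 1 by (simp add: distrib_left)
  qed
  have inB: "(\<lambda>t. P \<phi> (max 0 t)) \<in> bcontfun" for \<phi>
  proof -
    have "continuous_on UNIV (\<lambda>t. P \<phi> (max 0 t))"
      by (intro continuous_on_compose2[OF contP] continuous_intros) auto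
    moreover have "norm (P \<phi> (max 0 t)) \<le> norm x0 + (norm (f 0) + K * norm \<phi>) / (2 * K)" for t
      by (rule bdd) simp
    then have "bounded (range (\<lambda>t. P \<phi> (max 0 t)))"
      unfolding bounded_iff by blast
    ultimately show ?thesis by (simp add: bcontfun_def)
  qed
  define \<Psi> where "\<Psi> \<phi> = Bcontfun (\<lambda>t. P \<phi> (max 0 t))" for \<phi>
  have \<Psi>: "apply_bcontfun (\<Psi> \<phi>) t = P \<phi> (max 0 t)" for \<phi> t
    by (simp add: \<Psi>_def Bcontfun_inverse[OF inB])
  have contraction: "dist (\<Psi> \<phi>) (\<Psi> \<psi>) \<le> 1 / 2 * dist \<phi> \<psi>" for \<phi> \<psi>
  proof (rule dist_bound)
    fix t :: real
    define s where "s = max 0 t"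
    have s: "0 \<le> s" by (simp add: s_def)
    have "norm (integral {0..s} (\<lambda>r. g \<phi> r - g \<psi> r)) \<le> K * dist \<phi> \<psi> / (2 * K) * exp (2 * K * s)"
    proof (rule norm_integral_le_exp)
      fix r
      have "norm (g \<phi> r - g \<psi> r) \<le> K * norm (exp (2 * K * r) *\<^sub>R (\<phi> r - \<psi> r))"
        unfolding g_def using lipK by (metis scaleR_diff_right)
      also have "\<dots> \<le> K * (exp (2 * K * r) * dist \<phi> \<psi>)"
        using K dist_bounded[of \<phi> r \<psi>] by (auto simp: dist_norm)
      finally show "norm (g \<phi> r - g \<psi> r) \<le> K * dist \<phi> \<psi> * exp (2 * K * r)"
        by (simp add: algebra_simps)
    qed (use K s contg in \<open>auto intro!: continuous_on_diff\<close>)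
    moreover have "integral {0..s} (\<lambda>r. g \<phi> r - g \<psi> r) = integral {0..s} (g \<phi>) - integral {0..s} (g \<psi>)"
      by (intro integral_diff integrable_continuous_interval contg)
    ultimately have "exp (- (2 * K * s)) * norm (integral {0..s} (g \<phi>) - integral {0..s} (g \<psi>))
        \<le> exp (- (2 * K * s)) * (K * dist \<phi> \<psi> / (2 * K) * exp (2 * K * s))"
      by (intro mult_left_mono) auto
    also have "\<dots> = 1 / 2 * dist \<phi> \<psi>"
      using K by (simp add: exp_minus)
    finally have le: "exp (- (2 * K * s)) * norm (integral {0..s} (g \<phi>) - integral {0..s} (g \<psi>))
        \<le> 1 / 2 * dist \<phi> \<psi>" .
    have "P \<phi> s - P \<psi> s = exp (- (2 * K * s)) *\<^sub>R (integral {0..s} (g \<phi>) - integral {0..s} (g \<psi>))"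
      by (simp add: P_def scaleR_diff_right[symmetric])
    then have "dist (P \<phi> s) (P \<psi> s)
        = exp (- (2 * K * s)) * norm (integral {0..s} (g \<phi>) - integral {0..s} (g \<psi>))"
      unfolding dist_norm by simp
    then show "dist (apply_bcontfun (\<Psi> \<phi>) t) (apply_bcontfun (\<Psi> \<psi>) t) \<le> 1 / 2 * dist \<phi> \<psi>"
      using le by (simp only: \<Psi> s_def[symmetric])
  qed
  have "\<exists>!\<phi>. \<Psi> \<phi> = \<phi>"
    using contraction by (intro banach_fix_type[of "1 / 2"]) auto
  then obtain \<phi> where fp: "\<Psi> \<phi> = \<phi>" by blast
  define \<gamma> where "\<gamma> t = x0 + integral {0..t} (g \<phi>)" for t
  have \<gamma>: "g \<phi> t = f (\<gamma> t)" if "0 \<le> t" for t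
  proof -
    have "apply_bcontfun \<phi> t = P \<phi> t"
      using \<Psi>[of \<phi> t] that by (simp add: fp)
    then show ?thesis
      by (simp add: g_def P_def \<gamma>_def exp_minus)
  qed
  show thesis
  proof
    show "\<gamma> 0 = x0" by (simp add: \<gamma>_def)
    fix t :: real assume t: "0 \<le> t"
    show "(\<gamma> has_vector_derivative f (\<gamma> t)) (at t within {0..})"
      unfolding \<gamma>[OF t, symmetric] unfolding \<gamma>_def
      using has_vector_derivative_add[OF has_vector_derivative_const
          indefinite_integral_has_vector_derivative[OF contg t]]
      by simp
  qed
qed

lemma has_vector_derivative_zero_constant_ray:
  fixes h :: "real \<Rightarrow> 'a::real_normed_vector"
  assumes "\<And>t. 0 \<le> t \<Longrightarrow> (h has_vector_derivative 0) (at t within {0..})" and "0 \<le> t"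
  shows "h t = h 0"
proof -
  obtain c where "\<forall>t\<in>{0..}. h t = c"
    using has_vector_derivative_zero_constant[of "{0::real..}" h] assms(1) by fastforce
  then show ?thesis using assms(2) by auto
qed

text \<open>The quotient is \<open>B x e\<close> with \<open>e\<close> the unit vector of \<open>x\<close>, and \<open>norm x\<close> times the
variation of \<open>e\<close> is at most twice the variation of \<open>x\<close>.\<close>

lemma lipschitz_bilinear_div_norm:
  fixes B :: "'a::real_normed_vector \<Rightarrow> 'a \<Rightarrow> 'b::real_normed_vector"
  assumes "bounded_bilinear B"
  shows "\<exists>L. \<forall>x y. norm (B x x /\<^sub>R norm x - B y y /\<^sub>R norm y) \<le> L * norm (x - y)"
proof -
  interpret bounded_bilinear B by fact
  obtain K where K: "0 < K" "\<And>a b. norm (B a b) \<le> norm a * norm b * K"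
    using pos_bounded by blast
  have "norm (B x x /\<^sub>R norm x - B y y /\<^sub>R norm y) \<le> 3 * K * norm (x - y)" for x y
  proof -
    define ex where "ex = x /\<^sub>R norm x"
    define ey where "ey = y /\<^sub>R norm y"
    have ex: "norm ex \<le> 1" by (simp add: ex_def divide_inverse[symmetric] mult.commute)
    have "norm (norm y *\<^sub>R (ex - ey)) \<le> 2 * norm (x - y)"
    proof (cases "x = 0")
      case True
      then show ?thesis by (cases "y = 0") (auto simp: ex_def ey_def)
    next
      case False
      have "norm y *\<^sub>R (ex - ey) = (norm y - norm x) *\<^sub>R ex + (x - y)"
        using False by (cases "y = 0") (auto simp: ex_def ey_def algebra_simps)
      also have "norm \<dots> \<le> \<bar>norm y - norm x\<bar> * norm ex + norm (x - y)"
        by (metis norm_scaleR norm_triangle_ineq)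
      also have "\<dots> \<le> norm (x - y) * 1 + norm (x - y)"
        using norm_triangle_ineq3[of y x] ex
        by (intro add_right_mono mult_mono) (auto simp: norm_minus_commute)
      finally show ?thesis by simp
    qed
    then have 1: "norm y * norm (ex - ey) \<le> 2 * norm (x - y)" by simp
    have "B x x /\<^sub>R norm x - B y y /\<^sub>R norm y = B (x - y) ex + B y (ex - ey)"
      by (simp add: ex_def ey_def diff_left diff_right scaleR_right algebra_simps)
    also have "norm \<dots> \<le> norm (x - y) * norm ex * K + norm y * norm (ex - ey) * K"
      using norm_triangle_mono[OF K(2) K(2)] .
    also have "\<dots> \<le> norm (x - y) * 1 * K + 2 * norm (x - y) * K"
      using K ex 1 by (intro add_mono mult_right_mono mult_left_mono) auto
    finally show ?thesis by (simp add: algebra_simps)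
  qed
  then show ?thesis by blast
qed

text \<open>A quadratic field is not globally Lipschitz, but it agrees on the sphere through \<open>z0\<close> with its
rescaling \<open>norm z0 * B z z / norm z\<close>, which is. The rescaled field is still orthogonal to \<open>z\<close>, so its
solutions stay on the sphere.\<close>

theorem quadratic_ode_global_solution:
  fixes B :: "'a::{real_inner,banach} \<Rightarrow> 'a \<Rightarrow> 'a"
  assumes B: "bounded_bilinear B" and orth: "\<And>z. z \<bullet> B z z = 0"
  obtains \<gamma> where "\<gamma> 0 = z0"
    "\<And>t. 0 \<le> t \<Longrightarrow> (\<gamma> has_vector_derivative B (\<gamma> t) (\<gamma> t)) (at t within {0..})"
proof (cases "z0 = 0")
  case True
  show thesis
    by (rule that[of "\<lambda>_. 0"]) (auto simp: True bounded_bilinear.zero_left[OF B])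
next
  case False
  define f where "f z = norm z0 *\<^sub>R (B z z /\<^sub>R norm z)" for z
  obtain L where L: "\<And>x y. norm (B x x /\<^sub>R norm x - B y y /\<^sub>R norm y) \<le> L * norm (x - y)"
    using lipschitz_bilinear_div_norm[OF B] by blast
  have "norm (f x - f y) \<le> norm z0 * L * norm (x - y)" for x y
    using mult_left_mono[OF L[of x y], of "norm z0"]
    unfolding f_def by (simp add: scaleR_diff_right[symmetric] mult.assoc del: scaleR_scaleR)
  then obtain \<gamma> where \<gamma>: "\<gamma> 0 = z0"
    "\<And>t. 0 \<le> t \<Longrightarrow> (\<gamma> has_vector_derivative f (\<gamma> t)) (at t within {0..})"
    using lipschitz_ode_global_solution by blast
  have "\<gamma> t \<bullet> \<gamma> t = \<gamma> 0 \<bullet> \<gamma> 0" if "0 \<le> t" for t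
  proof (rule has_vector_derivative_zero_constant_ray[OF _ that])
    fix s :: real assume s: "0 \<le> s"
    have "((\<lambda>t. \<gamma> t \<bullet> \<gamma> t) has_vector_derivative \<gamma> s \<bullet> f (\<gamma> s) + f (\<gamma> s) \<bullet> \<gamma> s) (at s within {0..})"
      by (intro bounded_bilinear.has_vector_derivative[OF bounded_bilinear_inner] \<gamma>(2) s)
    then show "((\<lambda>t. \<gamma> t \<bullet> \<gamma> t) has_vector_derivative 0) (at s within {0..})"
      by (simp add: f_def inner_commute[of "B _ _"] orth)
  qed
  then have "norm (\<gamma> t) = norm z0" if "0 \<le> t" for t
    using that by (simp add: norm_eq_sqrt_inner \<gamma>(1))
  then have "f (\<gamma> t) = B (\<gamma> t) (\<gamma> t)" if "0 \<le> t" for t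
    using that False by (simp add: f_def)
  then show thesis
    using that \<gamma> by metis
qed

section \<open>Instability from a growing function\<close>

lemma exponential_growth:
  fixes f :: "real \<Rightarrow> real"
  assumes deriv: "\<And>t. 0 \<le> t \<Longrightarrow> \<exists>d. (f has_real_derivative d) (at t within {0..}) \<and> k * f t \<le> d"
    and "0 \<le> t"
  shows "f 0 * exp (k * t) \<le> f t"
proof -
  have "\<forall>s. \<exists>d. 0 \<le> s \<longrightarrow> (f has_real_derivative d) (at s within {0..}) \<and> k * f s \<le> d"
    using deriv by blast
  from choice[OF this] obtain d
    where d: "\<And>s. 0 \<le> s \<Longrightarrow> (f has_real_derivative d s) (at s within {0..})"
      "\<And>s. 0 \<le> s \<Longrightarrow> k * f s \<le> d s" by blast
  have D: "((\<lambda>s. exp (- k * s) * f s) has_real_derivative exp (- k * s) * (d s - k * f s)) (at s within {0..})"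
    if "0 \<le> s" for s
    using d(1)[OF that] by (auto intro!: derivative_eq_intros simp: algebra_simps)
  have "exp (- k * 0) * f 0 \<le> exp (- k * t) * f t"
  proof (rule DERIV_nonneg_imp_increasing_open[where f = "\<lambda>s. exp (- k * s) * f s"])
    fix s assume "0 < s" "s < t"
    then have "((\<lambda>s. exp (- k * s) * f s) has_real_derivative exp (- k * s) * (d s - k * f s)) (at s)"
      using D[of s] at_within_interior[of s "{0..}"] by simp
    then show "\<exists>y. ((\<lambda>s. exp (- k * s) * f s) has_real_derivative y) (at s) \<and> 0 \<le> y"
      using d(2)[of s] \<open>0 < s\<close> by (intro exI conjI) auto
  next
    show "continuous_on {0..t} (\<lambda>s. exp (- k * s) * f s)"
      using DERIV_continuous_on[of "{0..}", OF D] by (rule continuous_on_subset) auto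
  qed fact
  then show ?thesis by (simp add: exp_minus field_simps)
qed

text \<open>Chetaev's criterion: as long as a solution stays in the ball, \<open>V\<close> grows exponentially along it, but \<open>V\<close>
is bounded on the ball.\<close>

lemma chetaev_instability:
  fixes V :: "mat4 \<Rightarrow> real"
  assumes "0 < k" "0 < \<epsilon>"
    and growth: "\<And>\<gamma> t. solution_in S X \<gamma> \<Longrightarrow> 0 \<le> t \<Longrightarrow> dist (\<gamma> t) M < \<epsilon> \<Longrightarrow>
      \<exists>d. ((\<lambda>t. V (\<gamma> t)) has_real_derivative d) (at t within {0..}) \<and> k * V (\<gamma> t) \<le> d"
    and bound: "\<And>N. N \<in> S \<Longrightarrow> dist N M < \<epsilon> \<Longrightarrow> V N \<le> b"
    and start: "\<And>\<delta>. 0 < \<delta> \<Longrightarrow> \<exists>\<gamma>. solution_in S X \<gamma> \<and> dist (\<gamma> 0) M < \<delta> \<and> 0 < V (\<gamma> 0)"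
  shows "unstable_in S X M"
proof
  assume "lyapunov_stable_in S X M"
  then obtain \<delta> where \<delta>: "0 < \<delta>"
    "\<And>\<gamma>. solution_in S X \<gamma> \<Longrightarrow> dist (\<gamma> 0) M < \<delta> \<Longrightarrow> \<forall>t\<ge>0. dist (\<gamma> t) M < \<epsilon>"
    using \<open>0 < \<epsilon>\<close> unfolding lyapunov_stable_in_def by meson
  obtain \<gamma> where sol: "solution_in S X \<gamma>" "dist (\<gamma> 0) M < \<delta>" and V: "0 < V (\<gamma> 0)"
    using start[OF \<delta>(1)] by blast
  have near: "dist (\<gamma> t) M < \<epsilon>" if "0 \<le> t" for t
    using \<delta>(2)[OF sol] that by blast
  have "V (\<gamma> 0) * exp (k * t) \<le> b" if "0 \<le> t" for t
  proof -
    have "V (\<gamma> 0) * exp (k * t) \<le> V (\<gamma> t)"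
      using exponential_growth[of "\<lambda>t. V (\<gamma> t)" k t] growth[OF sol(1) _ near] that by blast
    also have "\<dots> \<le> b"
      using bound near that sol(1) by (simp add: solution_in_def)
    finally show ?thesis .
  qed
  note le = this
  \<comment> \<open>At this time already the linear lower bound \<open>V (\<gamma> 0) k t\<close> for the exponential reaches \<open>\<bar>b\<bar>\<close>.\<close>
  define t where "t = \<bar>b\<bar> / (V (\<gamma> 0) * k)"
  have t: "0 \<le> t" using V \<open>0 < k\<close> by (simp add: t_def)
  have "b \<le> V (\<gamma> 0) * (k * t)"
    using V \<open>0 < k\<close> by (simp add: t_def)
  also have "\<dots> < V (\<gamma> 0) * exp (k * t)"
    using V exp_ge_add_one_self[of "k * t"] by (intro mult_strict_left_mono) linarith+
  finally show False using le[OF t] by simp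
qed

section \<open>The Lie algebra in coordinates\<close>

lemma mat4_eq_iff: "A = B \<longleftrightarrow> (\<forall>i. \<forall>j. A $ i $ j = B $ i $ j)" for A B :: mat4
  by (simp add: vec_eq_iff)

lemma xc_nth: "xc M $ 1 = M$3$2" "xc M $ 2 = M$1$3" "xc M $ 3 = M$2$1"
  and yc_nth: "yc M $ 1 = M$1$4" "yc M $ 2 = M$2$4" "yc M $ 3 = M$3$4"
  by (simp_all add: xc_def yc_def)

lemma so4_mat_in_so4 [simp]: "so4_mat x y \<in> so4"
  by (simp add: so4_def mat4_eq_iff forall_4 transpose_def so4_mat_nth)

lemma so4_mat_coords:
  assumes "M \<in> so4" shows "so4_mat (xc M) (yc M) = M"
proof -
  have skew: "M $ i $ j = - M $ j $ i" for i j
  proof -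
    have "transpose M $ j $ i = (- M) $ j $ i"
      using assms by (simp add: so4_def)
    then show ?thesis by (simp add: transpose_def)
  qed
  have "M $ i $ i = 0" for i
    using skew[of i i] by linarith
  then show ?thesis
    using skew[of 1 2] skew[of 2 3] skew[of 3 1] skew[of 4 1] skew[of 4 2] skew[of 4 3]
    by (simp add: vec_eq_iff forall_4 so4_mat_nth xc_nth yc_nth)
qed

lemma so4_cases [elim?]:
  assumes "M \<in> so4" obtains x y where "M = so4_mat x y"
  using so4_mat_coords[OF assms] by metis

lemma so4_mat_eq_iff [simp]: "so4_mat x y = so4_mat x' y' \<longleftrightarrow> x = x' \<and> y = y'"
  by (metis xc_so4_mat yc_so4_mat)

lemma xc_diff: "xc (A - B) = xc A - xc B" and yc_diff: "yc (A - B) = yc A - yc B"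
  by (simp_all add: vec_eq_iff forall_3 xc_nth yc_nth)

lemma so4_mat_add: "so4_mat x y + so4_mat x' y' = so4_mat (x + x') (y + y')"
  and so4_mat_scaleR: "c *\<^sub>R so4_mat x y = so4_mat (c *\<^sub>R x) (c *\<^sub>R y)"
  and so4_mat_zero: "so4_mat 0 0 = 0"
  by (simp_all add: mat4_eq_iff forall_4 so4_mat_nth)

lemma lie_so4_mat:
  "lie (so4_mat x y) (so4_mat x' y') = so4_mat (cross3 x x' + cross3 y y') (cross3 x y' + cross3 y x')"
  by (simp add: mat4_eq_iff forall_4 lie_def matrix_matrix_mult_def sum_4 so4_mat_nth cross3_def algebra_simps)

lemma ip_so4_mat: "ip (so4_mat x y) (so4_mat x' y') = x \<bullet> x' + y \<bullet> y'"
  by (simp add: ip_def trace_def matrix_matrix_mult_def sum_4 so4_mat_nth inner_vec_def sum_3 algebra_simps)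

text \<open>Invariance of the trace form under the adjoint action; it shows that the orbit form depends on its
first argument only through the tangent vector \<open>[M, X]\<close>.\<close>

lemma trace_lie_so4_mat:
  "1/2 * trace (so4_mat x y ** lie (so4_mat x' y') (so4_mat x'' y''))
     = - ip (lie (so4_mat x y) (so4_mat x' y')) (so4_mat x'' y'')"
  unfolding lie_so4_mat ip_so4_mat
  by (simp add: trace_def matrix_matrix_mult_def sum_4 so4_mat_nth inner_vec_def sum_3 cross3_def algebra_simps)

lemma bounded_linear_so4_mat: "bounded_linear (\<lambda>z. so4_mat (fst z) (snd z))"
  by (intro linear_conv_bounded_linear[THEN iffD1] linearI)
     (simp_all add: so4_mat_add so4_mat_scaleR)

lemma in_Orb_so4_mat:
  "so4_mat x y \<in> Orb c1 c2 \<longleftrightarrow> x \<bullet> x + y \<bullet> y = 2 * c1 \<and> x \<bullet> y = c2"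
  by (auto simp: Orb_def C1_def C2_def xc_so4_mat yc_so4_mat inner_vec_def power2_eq_square)

section \<open>Diagonal quadratic Hamiltonians\<close>

definition diag_op :: "real^3 \<Rightarrow> real^3 \<Rightarrow> mat4 \<Rightarrow> mat4" where
  "diag_op k l M = so4_mat (k * xc M) (l * yc M)"

text \<open>The common form of \<open>H\<close> and \<open>I\<close>; its gradient on \<open>so4\<close> is \<open>diag_op k l\<close>.\<close>

definition diag_energy :: "real^3 \<Rightarrow> real^3 \<Rightarrow> mat4 \<Rightarrow> real" where
  "diag_energy k l M = 1 / 2 * ((k * xc M) \<bullet> xc M + (l * yc M) \<bullet> yc M)"

lemma bounded_linear_diag_op: "bounded_linear (diag_op k l)"
  by (intro linear_conv_bounded_linear[THEN iffD1] linearI)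
     (simp_all add: diag_op_def mat4_eq_iff forall_4 so4_mat_nth xc_nth yc_nth algebra_simps)

lemma bounded_linear_xc: "bounded_linear xc" and bounded_linear_yc: "bounded_linear yc"
  by (intro linear_conv_bounded_linear[THEN iffD1] linearI;
      simp add: vec_eq_iff forall_3 xc_nth yc_nth)+

lemma bounded_linear_pointwise_mult: "bounded_linear ((*) k)" for k :: "real^'n"
  by (intro linear_conv_bounded_linear[THEN iffD1] linearI) (simp_all add: vec_eq_iff algebra_simps)

lemma inner_pointwise_mult: "x \<bullet> (k * y) = (k * x) \<bullet> y" for k x y :: "real^'n"
  by (simp add: inner_vec_def mult.left_commute mult.assoc)

lemma quadratic_has_derivative:
  fixes X :: "'a::real_normed_vector \<Rightarrow> real^'n"
  assumes "bounded_linear X"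
  shows "((\<lambda>M. (k * X M) \<bullet> X M) has_derivative (\<lambda>v. 2 * ((k * X M) \<bullet> X v))) (at M within S)"
proof -
  have "((\<lambda>M. (k * X M) \<bullet> X M) has_derivative (\<lambda>v. (k * X M) \<bullet> X v + (k * X v) \<bullet> X M)) (at M within S)"
    by (intro bounded_bilinear.FDERIV[OF bounded_bilinear_inner]
        bounded_linear.has_derivative[OF bounded_linear_pointwise_mult]
        bounded_linear_imp_has_derivative assms)
  moreover have "(k * X v) \<bullet> X M = (k * X M) \<bullet> X v" for v
    by (metis inner_commute inner_pointwise_mult)
  ultimately show ?thesis by simp
qed

lemma diag_energy_has_derivative:
  "(diag_energy k l has_derivative (\<lambda>v. (k * xc M) \<bullet> xc v + (l * yc M) \<bullet> yc v)) (at M within S)"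
proof -
  have "(diag_energy k l has_derivative
      (\<lambda>v. (1 / 2) * (2 * ((k * xc M) \<bullet> xc v) + 2 * ((l * yc M) \<bullet> yc v)))) (at M within S)"
    unfolding diag_energy_def[abs_def]
    by (intro has_derivative_mult_right has_derivative_add quadratic_has_derivative
        bounded_linear_xc bounded_linear_yc)
  then show ?thesis by (simp add: distrib_left)
qed

lemma ip_coords: "G \<in> so4 \<Longrightarrow> v \<in> so4 \<Longrightarrow> ip G v = xc G \<bullet> xc v + yc G \<bullet> yc v"
  using ip_so4_mat[of "xc G" "yc G" "xc v" "yc v"] by (simp add: so4_mat_coords)

lemma subspace_so4: "subspace so4"
proof (rule subspaceI)
  show "0 \<in> so4" using so4_mat_in_so4[of 0 0] by (simp add: so4_mat_zero)
next
  fix M N assume "M \<in> so4" "N \<in> so4"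
  then show "M + N \<in> so4" by (elim so4_cases) (simp add: so4_mat_add)
next
  fix c :: real and M assume "M \<in> so4"
  then show "c *\<^sub>R M \<in> so4" by (elim so4_cases) (simp add: so4_mat_scaleR)
qed

text \<open>Uniqueness of the derivative along the subspace, which makes both the gradient and the linearization
well defined: restricting to the line through \<open>M\<close> in direction \<open>v\<close> reduces it to one variable.\<close>

lemma has_derivative_within_subspace_unique:
  assumes "subspace S" "M \<in> S" "v \<in> S"
    and "(F has_derivative D) (at M within S)" "(F has_derivative D') (at M within S)"
  shows "D v = D' v"
proof -
  have *: "((\<lambda>t. F (M + t *\<^sub>R v)) has_derivative (\<lambda>t. D'' (t *\<^sub>R v))) (at 0)"
    if "(F has_derivative D'') (at M within S)" for D''
  proof -
    have sub: "range (\<lambda>t. M + t *\<^sub>R v) \<subseteq> S"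
      using assms(1-3) by (auto simp: subspace_add subspace_scale)
    have "((\<lambda>t. M + t *\<^sub>R v) has_derivative (\<lambda>t. t *\<^sub>R v)) (at 0)"
      by (auto intro!: derivative_eq_intros)
    moreover have "(F has_derivative D'') (at (M + 0 *\<^sub>R v) within range (\<lambda>t. M + t *\<^sub>R v))"
      using has_derivative_subset[OF that sub] by simp
    ultimately show ?thesis
      by (rule has_derivative_in_compose)
  qed
  have "(\<lambda>t. D (t *\<^sub>R v)) = (\<lambda>t. D' (t *\<^sub>R v))"
    using has_derivative_unique[OF *[OF assms(4)] *[OF assms(5)]] .
  from fun_cong[OF this, of 1] show ?thesis by simp
qed

lemma ip_self_eq_0:
  assumes "G \<in> so4" "ip G G = 0" shows "G = 0"
proof -
  have "xc G \<bullet> xc G + yc G \<bullet> yc G = 0"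
    using assms ip_coords by metis
  then have "xc G = 0" "yc G = 0"
    using inner_ge_zero[of "xc G"] inner_ge_zero[of "yc G"] by (metis add_nonneg_eq_0_iff inner_eq_zero_iff)+
  then show ?thesis
    using so4_mat_coords[OF assms(1)] so4_mat_zero by simp
qed

lemma has_derivative_within_cong_on_subspace:
  assumes "(F has_derivative D) (at M within S)" "bounded_linear D'" "\<And>v. v \<in> S \<Longrightarrow> D v = D' v"
    and "subspace S" "M \<in> S"
  shows "(F has_derivative D') (at M within S)"
proof -
  have "((\<lambda>y. ((F y - F M) - D (y - M)) /\<^sub>R norm (y - M)) \<longlongrightarrow> 0) (at M within S)"
    using assms(1) by (simp add: has_derivative_at_within)
  then have "((\<lambda>y. ((F y - F M) - D' (y - M)) /\<^sub>R norm (y - M)) \<longlongrightarrow> 0) (at M within S)"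
    by (rule Lim_transform_within[OF _ zero_less_one]) (use assms in \<open>auto simp: subspace_diff\<close>)
  then show ?thesis
    using assms(2) by (simp add: has_derivative_at_within)
qed

lemma bounded_linear_ip: "bounded_linear (ip G)"
  unfolding ip_def
  by (intro linear_conv_bounded_linear[THEN iffD1] linearI)
     (simp_all add: matrix_add_ldistrib trace_add trace_def matrix_matrix_mult_def sum_4 algebra_simps)

lemma grad_diag_energy:
  assumes "M \<in> so4"
  shows "grad (diag_energy k l) M = diag_op k l M"
    and "(diag_energy k l has_derivative ip (diag_op k l M)) (at M within so4)"
proof -
  let ?G = "diag_op k l M"
  have G: "?G \<in> so4" by (simp add: diag_op_def)
  have eq: "(k * xc M) \<bullet> xc v + (l * yc M) \<bullet> yc v = ip ?G v" if "v \<in> so4" for v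
    using that by (simp add: ip_coords diag_op_def xc_so4_mat yc_so4_mat)
  show deriv: "(diag_energy k l has_derivative ip ?G) (at M within so4)"
    by (rule has_derivative_within_cong_on_subspace[OF diag_energy_has_derivative bounded_linear_ip eq subspace_so4 assms])
  show "grad (diag_energy k l) M = ?G"
    unfolding grad_def
  proof (rule the_equality)
    show "?G \<in> so4 \<and> (diag_energy k l has_derivative ip ?G) (at M within so4)"
      using G deriv ..
    fix G' assume G': "G' \<in> so4 \<and> (diag_energy k l has_derivative ip G') (at M within so4)"
    then have d: "G' - ?G \<in> so4" using G by (simp add: subspace_diff[OF subspace_so4])
    have "ip G' (G' - ?G) = ip ?G (G' - ?G)"
      using has_derivative_within_subspace_unique[OF subspace_so4 assms d] G' deriv by blast
    then have "ip (G' - ?G) (G' - ?G) = 0"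
      using G G' d by (simp add: ip_coords xc_diff yc_diff inner_diff_left)
    then show "G' = ?G" using ip_self_eq_0[OF d] by simp
  qed
qed

section \<open>Endomorphisms of the tangent space as matrices\<close>

text \<open>The coordinates \<open>(x\<^sub>2, y\<^sub>2, x\<^sub>3, y\<^sub>3)\<close> on the space \<open>x\<^sub>1 = y\<^sub>1 = 0\<close>; the order puts \<open>\<xi>\<close> before \<open>\<eta>\<close>.\<close>

definition emb :: "real^4 \<Rightarrow> mat4" where
  "emb z = so4_mat (vector [0, z$1, z$3]) (vector [0, z$2, z$4])"

text \<open>The left inverse of \<open>emb\<close> that vanishes on the orthogonal complement of its range, in particular on
the symmetric matrices; hence the differences of transposed entries.\<close>

definition prj :: "mat4 \<Rightarrow> real^4" where
  "prj M = vector [(M$1$3 - M$3$1) / 2, (M$2$4 - M$4$2) / 2, (M$2$1 - M$1$2) / 2, (M$3$4 - M$4$3) / 2]"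

text \<open>The orthogonal complement of \<open>t1\<close> in \<open>so4\<close>.\<close>

definition t1_perp :: "mat4 set" where
  "t1_perp = range emb"

lemma vector_4_nth [simp]: "(vector [a, b, c, d] :: 'a::zero^4) $ 1 = a"
  "(vector [a, b, c, d] :: 'a::zero^4) $ 2 = b" "(vector [a, b, c, d] :: 'a::zero^4) $ 3 = c"
  "(vector [a, b, c, d] :: 'a::zero^4) $ 4 = d"
  by (simp_all add: vector_def)

lemma prj_so4_mat: "prj (so4_mat x y) = vector [x$2, y$2, x$3, y$3]"
  by (simp add: prj_def so4_mat_nth vec_eq_iff forall_4)

lemma prj_emb [simp]: "prj (emb z) = z"
  by (simp add: emb_def prj_so4_mat vec_eq_iff forall_4)

lemma inj_emb: "emb z = emb w \<longleftrightarrow> z = w"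
  by (metis prj_emb)

lemma bounded_linear_emb: "bounded_linear emb"
  by (intro linear_conv_bounded_linear[THEN iffD1] linearI)
     (simp_all add: emb_def mat4_eq_iff forall_4 so4_mat_nth)

lemma bounded_linear_prj: "bounded_linear prj"
  by (intro linear_conv_bounded_linear[THEN iffD1] linearI)
     (simp_all add: prj_def vec_eq_iff forall_4 field_simps)

lemma inner_emb: "M \<bullet> emb z = 2 * (prj M \<bullet> z)"
  by (simp add: emb_def prj_def inner_vec_def sum_4 so4_mat_nth field_simps)

lemma t1_perp_subset_so4: "t1_perp \<subseteq> so4"
  by (auto simp: t1_perp_def emb_def)

lemma orthogonal_t1_perp: "(\<forall>w\<in>t1_perp. M \<bullet> w = 0) \<longleftrightarrow> prj M = 0"
  by (auto simp: t1_perp_def inner_emb)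

definition lift_mat :: "mat4 \<Rightarrow> endo" where
  "lift_mat B = Blinfun (\<lambda>M. emb (B *v prj M))"

lemma lift_mat_apply: "blinfun_apply (lift_mat B) M = emb (B *v prj M)"
  unfolding lift_mat_def
  by (subst bounded_linear_Blinfun_apply)
     (auto intro!: bounded_linear_compose[OF bounded_linear_emb]
        bounded_linear_compose[OF matrix_vector_mul_bounded_linear] bounded_linear_prj)

lemma emb_simps: "emb (z + w) = emb z + emb w" "emb (z - w) = emb z - emb w" "emb (c *\<^sub>R z) = c *\<^sub>R emb z" "emb 0 = 0"
  using bounded_linear.linear[OF bounded_linear_emb]
  by (simp_all add: linear_add linear_diff linear_scale linear_0)

lemma lift_mat_in_endos: "lift_mat B \<in> endos t1_perp"
  unfolding endos_def mem_Collect_eq orthogonal_t1_perp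
  by (auto simp: lift_mat_apply t1_perp_def emb_simps)

lemma endos_eqI:
  assumes "A \<in> endos t1_perp" "A' \<in> endos t1_perp"
    and eq: "\<And>z. blinfun_apply A (emb z) = blinfun_apply A' (emb z)"
  shows "A = A'"
proof (rule blinfun_eqI)
  fix M
  have "blinfun_apply B M = blinfun_apply B (emb (prj M))" if "B \<in> endos t1_perp" for B
  proof -
    have "prj (M - emb (prj M)) = 0"
      using bounded_linear.linear[OF bounded_linear_prj] by (simp add: linear_diff)
    then have "blinfun_apply B (M - emb (prj M)) = 0"
      using that unfolding endos_def mem_Collect_eq orthogonal_t1_perp by blast
    then show ?thesis by (simp add: blinfun.diff_right)
  qed
  then show "blinfun_apply A M = blinfun_apply A' M"
    using assms by metis
qed

text \<open>Together with \<open>comm_lift_mat\<close> this identifies the Lie algebra \<open>endos t1_perp\<close> with the Lie algebra of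
four by four matrices.\<close>

lemma endos_t1_perp: "endos t1_perp = range lift_mat"
proof
  show "endos t1_perp \<subseteq> range lift_mat"
  proof
    fix A assume A: "A \<in> endos t1_perp"
    have "linear (\<lambda>z. prj (blinfun_apply A (emb z)))"
      by (intro bounded_linear.linear bounded_linear_compose[OF bounded_linear_prj]
          bounded_linear_compose[OF blinfun.bounded_linear_right] bounded_linear_emb)
    then have "matrix (\<lambda>z. prj (blinfun_apply A (emb z))) *v z = prj (blinfun_apply A (emb z))" for z
      by (simp add: matrix_works)
    moreover have "emb (prj (blinfun_apply A M)) = blinfun_apply A M" for M
    proof -
      have "blinfun_apply A M \<in> range emb"
        using A by (simp add: endos_def t1_perp_def)
      then show ?thesis by auto
    qed
    ultimately have "A = lift_mat (matrix (\<lambda>z. prj (blinfun_apply A (emb z))))"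
      by (intro endos_eqI[OF A lift_mat_in_endos]) (simp add: lift_mat_apply)
    then show "A \<in> range lift_mat" by blast
  qed
qed (use lift_mat_in_endos in blast)

lemma lift_mat_add: "lift_mat (A + B) = lift_mat A + lift_mat B"
  and lift_mat_scaleR: "lift_mat (c *\<^sub>R A) = c *\<^sub>R lift_mat A"
  by (auto intro!: blinfun_eqI simp: lift_mat_apply plus_blinfun.rep_eq minus_blinfun.rep_eq
      scaleR_blinfun.rep_eq emb_simps matrix_vector_mult_add_rdistrib matrix_vector_mult_diff_rdistrib
      scaleR_matrix_vector_assoc[symmetric])

lemma comm_lift_mat: "comm (lift_mat A) (lift_mat B) = lift_mat (A ** B - B ** A)"
  by (auto intro!: blinfun_eqI simp: comm_def lift_mat_apply minus_blinfun.rep_eq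
      emb_simps matrix_vector_mult_diff_rdistrib matrix_vector_mul_assoc)

section \<open>Tangent space and symplectic form at the equilibria\<close>

text \<open>The map \<open>X \<mapsto> [M1 p q, X]\<close> read in the coordinates of \<open>t1_perp\<close>.\<close>

definition ad_perp :: "real \<Rightarrow> real \<Rightarrow> real^4 \<Rightarrow> real^4" where
  "ad_perp p q z = vector [- (p * z$3 + q * z$4), - (q * z$3 + p * z$4), p * z$1 + q * z$2, q * z$1 + p * z$2]"

definition ad_perp_inv :: "real \<Rightarrow> real \<Rightarrow> real^4 \<Rightarrow> real^4" where
  "ad_perp_inv p q z = (1 / (q\<^sup>2 - p\<^sup>2)) *\<^sub>R
     vector [q * z$4 - p * z$3, q * z$3 - p * z$4, p * z$1 - q * z$2, p * z$2 - q * z$1]"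

lemma ad_perp_inverse:
  assumes "p\<^sup>2 \<noteq> q\<^sup>2"
  shows "ad_perp p q (ad_perp_inv p q z) = z" "ad_perp_inv p q (ad_perp p q z) = z"
proof -
  define c where "c = 1 / (q\<^sup>2 - p\<^sup>2)"
  have c: "c * (q\<^sup>2 - p\<^sup>2) = 1" using assms by (simp add: c_def)
  show "ad_perp p q (ad_perp_inv p q z) = z" "ad_perp_inv p q (ad_perp p q z) = z"
    unfolding ad_perp_def ad_perp_inv_def c_def[symmetric] vec_eq_iff forall_4
      vector_4_nth vector_scaleR_component real_scaleR_def
    using c by (intro conjI; algebra)+
qed

lemma lie_M1:
  assumes "X \<in> so4" shows "lie (M1 p q) X = emb (ad_perp p q (prj X))"
  using assms
proof (cases rule: so4_cases)
  case (1 x y)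
  show ?thesis
    unfolding 1 M1_def lie_so4_mat emb_def ad_perp_def prj_def so4_mat_eq_iff
    by (simp add: so4_mat_nth vec_eq_iff forall_3 cross3_def)
qed

text \<open>The bracket with \<open>M1 p q\<close> is invertible on \<open>t1_perp\<close>, with determinant \<open>(q\<^sup>2 - p\<^sup>2)\<^sup>2\<close>.\<close>

lemma tangent_M1:
  assumes "p\<^sup>2 \<noteq> q\<^sup>2" shows "tangent (M1 p q) = t1_perp"
proof
  show "tangent (M1 p q) \<subseteq> t1_perp"
    by (auto simp: tangent_def t1_perp_def lie_M1)
  show "t1_perp \<subseteq> tangent (M1 p q)"
  proof
    fix v assume "v \<in> t1_perp"
    then obtain z where z: "v = emb z" by (auto simp: t1_perp_def)
    have so: "emb (ad_perp_inv p q z) \<in> so4" by (simp add: emb_def)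
    have "v = lie (M1 p q) (emb (ad_perp_inv p q z))"
      using lie_M1[OF so, of p q] assms z by (simp add: ad_perp_inverse)
    then show "v \<in> tangent (M1 p q)" using so by (auto simp: tangent_def)
  qed
qed

definition perp_form :: "real \<Rightarrow> real \<Rightarrow> real^4 \<Rightarrow> real^4 \<Rightarrow> real" where
  "perp_form p q u v = - (u \<bullet> ad_perp_inv p q v)"

lemma orb_form_M1:
  assumes "p\<^sup>2 \<noteq> q\<^sup>2" shows "orb_form (M1 p q) (emb u) (emb v) = perp_form p q u v"
  unfolding orb_form_def
proof (rule the_equality)
  have *: "1/2 * trace (M1 p q ** lie X Y) = perp_form p q u v"
    if X: "X \<in> so4" "emb u = lie (M1 p q) X" and Y: "Y \<in> so4" "emb v = lie (M1 p q) Y" for X Y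
  proof -
    have "1/2 * trace (M1 p q ** lie X Y) = - ip (lie (M1 p q) X) Y"
      using X(1) Y(1) by (metis M1_def so4_cases trace_lie_so4_mat)
    also have "\<dots> = - (u \<bullet> prj Y)"
      using Y(1)
    proof (cases rule: so4_cases)
      case (1 x y)
      show ?thesis
        unfolding X(2)[symmetric] unfolding 1 emb_def ip_so4_mat
        by (simp add: prj_def inner_vec_def sum_3 sum_4 so4_mat_nth)
    qed
    also have "prj Y = ad_perp_inv p q v"
      using Y assms by (metis lie_M1 inj_emb ad_perp_inverse(2))
    finally show ?thesis by (simp add: perp_form_def)
  qed
  have so: "emb (ad_perp_inv p q z) \<in> so4" for z by (simp add: emb_def)
  have "emb z = lie (M1 p q) (emb (ad_perp_inv p q z))" for z
    using lie_M1[OF so, of p q] assms by (simp add: ad_perp_inverse)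
  then show "\<exists>X\<in>so4. \<exists>Y\<in>so4. emb u = lie (M1 p q) X \<and> emb v = lie (M1 p q) Y \<and>
      perp_form p q u v = 1/2 * trace (M1 p q ** lie X Y)"
    using * so by metis
  show "r = perp_form p q u v" if "\<exists>X\<in>so4. \<exists>Y\<in>so4. emb u = lie (M1 p q) X \<and> emb v = lie (M1 p q) Y \<and>
      r = 1/2 * trace (M1 p q ** lie X Y)" for r
    using that * by metis
qed

section \<open>Linearization at the equilibria\<close>

definition lin_mat :: "real \<Rightarrow> real \<Rightarrow> real^3 \<Rightarrow> real^3 \<Rightarrow> mat4" where
  "lin_mat p q k l = vector
    [vector [0, 0, p * (k$1 - k$3), q * (l$1 - l$3)],
     vector [0, 0, q * (l$1 - k$3), p * (k$1 - l$3)],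
     vector [p * (k$2 - k$1), q * (l$2 - l$1), 0, 0],
     vector [q * (k$2 - l$1), p * (l$2 - k$1), 0, 0]]"

lemma bounded_bilinear_lie: "bounded_bilinear lie"
  by (intro bilinear_conv_bounded_bilinear[THEN iffD1])
     (auto simp: bilinear_def lie_def mat4_eq_iff matrix_matrix_mult_def sum_4 algebra_simps intro!: linearI)

lemma ham_field_diag_energy:
  "M \<in> so4 \<Longrightarrow> ham_field (diag_energy k l) M = lie M (diag_op k l M)"
  by (simp add: ham_field_def grad_diag_energy)

lemma M1_in_so4 [simp]: "M1 p q \<in> so4"
  by (simp add: M1_def)

text \<open>On \<open>so4\<close> the Hamiltonian field is the quadratic map \<open>N \<mapsto> [N, diag_op k l N]\<close>, whose derivative at \<open>M\<close> is
\<open>v \<mapsto> [M, diag_op k l v] + [v, diag_op k l M]\<close>.\<close>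

lemma linearization_diag_energy:
  assumes "p\<^sup>2 \<noteq> q\<^sup>2"
  shows "linearization (diag_energy k l) (M1 p q) = lift_mat (lin_mat p q k l)"
  unfolding linearization_def tangent_M1[OF assms]
proof (rule the_equality)
  let ?M = "M1 p q"
  define D where "D v = lie ?M (diag_op k l v) + lie v (diag_op k l ?M)" for v
  have "((\<lambda>M. lie M (diag_op k l M)) has_derivative D) (at ?M within so4)"
    unfolding D_def
    by (intro bounded_bilinear.FDERIV[OF bounded_bilinear_lie] has_derivative_ident
        bounded_linear_imp_has_derivative[OF bounded_linear_diag_op])
  then have D: "(ham_field (diag_energy k l) has_derivative D) (at ?M within so4)"
    by (rule has_derivative_transform[rotated 2]) (simp_all add: ham_field_diag_energy)
  have D_emb: "D (emb z) = emb (lin_mat p q k l *v z)" for z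
    unfolding D_def M1_def emb_def diag_op_def xc_so4_mat yc_so4_mat lie_so4_mat so4_mat_add so4_mat_eq_iff
    by (simp add: vec_eq_iff forall_3 cross3_def matrix_vector_mult_def sum_4 lin_mat_def algebra_simps)
  show "lift_mat (lin_mat p q k l) \<in> endos t1_perp \<and>
      (\<exists>D. (ham_field (diag_energy k l) has_derivative D) (at ?M within so4) \<and>
        (\<forall>v\<in>t1_perp. blinfun_apply (lift_mat (lin_mat p q k l)) v = D v))"
    using D D_emb lift_mat_in_endos by (auto simp: t1_perp_def lift_mat_apply)
  fix A assume A: "A \<in> endos t1_perp \<and>
      (\<exists>D. (ham_field (diag_energy k l) has_derivative D) (at ?M within so4) \<and>
        (\<forall>v\<in>t1_perp. blinfun_apply A v = D v))"
  then obtain D' where D': "(ham_field (diag_energy k l) has_derivative D') (at ?M within so4)"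
    "\<And>v. v \<in> t1_perp \<Longrightarrow> blinfun_apply A v = D' v" by blast
  show "A = lift_mat (lin_mat p q k l)"
  proof (rule endos_eqI)
    fix z
    have "emb z \<in> t1_perp" by (simp add: t1_perp_def)
    moreover from this have "D' (emb z) = D (emb z)"
      using has_derivative_within_subspace_unique[OF subspace_so4 M1_in_so4 _ D'(1) D]
        t1_perp_subset_so4 by blast
    ultimately show "blinfun_apply A (emb z) = blinfun_apply (lift_mat (lin_mat p q k l)) (emb z)"
      using D'(2) by (simp add: D_emb lift_mat_apply)
  qed (use A lift_mat_in_endos in auto)
qed

lemma critical_diag_energy_M1:
  assumes "p\<^sup>2 \<noteq> q\<^sup>2"
  shows "critical_on_orbit (diag_energy k l) (M1 p q)"
  unfolding critical_on_orbit_def tangent_M1[OF assms]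
proof (intro exI conjI ballI)
  show "(diag_energy k l has_derivative ip (diag_op k l (M1 p q))) (at (M1 p q) within so4)"
    by (rule grad_diag_energy) simp
  show "ip (diag_op k l (M1 p q)) v = 0" if "v \<in> t1_perp" for v
    using that
    by (auto simp: t1_perp_def emb_def diag_op_def M1_def xc_so4_mat yc_so4_mat ip_so4_mat
        inner_vec_def sum_3)
qed

section \<open>Abelian subalgebras of the symplectic Lie algebra\<close>

text \<open>The symplectic Lie algebra of the standard form, as matrices.\<close>

definition sp_std :: "mat4 set" where
  "sp_std = {B. \<forall>u v. std_form (B *v u) v + std_form u (B *v v) = 0}"

text \<open>The matrix \<open>diag(X, - X\<^sup>T)\<close> for \<open>X = [[a, b], [c, d]]\<close>: the embedding of \<open>gl(2)\<close> that preserves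
the two standard Lagrangian planes.\<close>

definition gl2_block :: "real \<Rightarrow> real \<Rightarrow> real \<Rightarrow> real \<Rightarrow> mat4" where
  "gl2_block a b c d = vector
    [vector [a, b, 0, 0],
     vector [c, d, 0, 0],
     vector [0, 0, - a, - c],
     vector [0, 0, - b, - d]]"

lemma mat4_mult_component: "(A ** B) $ i $ j
    = A$i$1 * B$1$j + A$i$2 * B$2$j + A$i$3 * B$3$j + A$i$4 * B$4$j" for A B :: mat4
  by (simp add: matrix_matrix_mult_def sum_4)

lemma gl2_block_in_sp_std: "gl2_block a b c d \<in> sp_std"
  by (simp add: sp_std_def std_form_def gl2_block_def matrix_vector_mult_def sum_4 algebra_simps)

lemma gl2_block_commutator:
  "gl2_block a b c d ** gl2_block a' b' c' d' - gl2_block a' b' c' d' ** gl2_block a b c d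
    = gl2_block (b * c' - b' * c) (a * b' + b * d' - a' * b - b' * d)
        (c * a' + d * c' - c' * a - d' * c) (c * b' - c' * b)"
  by (simp add: mat4_eq_iff forall_4 mat4_mult_component gl2_block_def algebra_simps)

lemma gl2_block_eq_iff:
  "gl2_block a b c d = gl2_block a' b' c' d' \<longleftrightarrow> a = a' \<and> b = b' \<and> c = c' \<and> d = d'"
  by (auto simp: mat4_eq_iff forall_4 gl2_block_def)

lemma gl2_block_add: "gl2_block a b c d + gl2_block a' b' c' d' = gl2_block (a + a') (b + b') (c + c') (d + d')"
  and gl2_block_scaleR: "r *\<^sub>R gl2_block a b c d = gl2_block (r * a) (r * b) (r * c) (r * d)"
  by (simp_all add: mat4_eq_iff forall_4 gl2_block_def)

lemma sp_std_entries:
  assumes "B \<in> sp_std"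
  shows "B$3$3 = - B$1$1" "B$3$4 = - B$2$1" "B$4$3 = - B$1$2" "B$4$4 = - B$2$2"
proof -
  have *: "std_form (B *v u) v + std_form u (B *v v) = 0" for u v
    using assms by (simp add: sp_std_def)
  show "B$3$3 = - B$1$1" "B$3$4 = - B$2$1" "B$4$3 = - B$1$2" "B$4$4 = - B$2$2"
    using *[of "axis 1 1" "axis 3 1"] *[of "axis 1 1" "axis 4 1"]
      *[of "axis 2 1" "axis 3 1"] *[of "axis 2 1" "axis 4 1"]
    by (simp_all add: std_form_def matrix_vector_mult_def sum_4 axis_def)
qed

text \<open>The matrix \<open>diag(1, 1, -1, -1)\<close> acts on the off-diagonal two by two blocks of \<open>B\<close> by \<open>\<plusminus> 2\<close> and kills the diagonal ones.
The commutator with it is therefore block diagonal only if \<open>B\<close> is.\<close>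

lemma centralizes_grading_imp_gl2_block:
  assumes B: "B \<in> sp_std"
    and comm: "B ** gl2_block 1 0 0 1 - gl2_block 1 0 0 1 ** B = gl2_block a b c d"
  shows "B = gl2_block (B$1$1) (B$1$2) (B$2$1) (B$2$2)"
proof -
  have *: "(B ** gl2_block 1 0 0 1 - gl2_block 1 0 0 1 ** B) $ i $ j = gl2_block a b c d $ i $ j" for i j
    by (simp add: comm)
  have "B$1$3 = 0" "B$1$4 = 0" "B$2$3 = 0" "B$2$4 = 0" "B$3$1 = 0" "B$3$2 = 0" "B$4$1 = 0" "B$4$2 = 0"
    using *[of 1 3] *[of 1 4] *[of 2 3] *[of 2 4] *[of 3 1] *[of 3 2] *[of 4 1] *[of 4 2]
    by (simp_all add: mat4_mult_component gl2_block_def)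
  then show ?thesis
    using sp_std_entries[OF B] by (simp add: mat4_eq_iff forall_4 gl2_block_def)
qed

text \<open>The span of \<open>X = [[a, b], [c, d]]\<close> and the identity, embedded by \<open>gl2_block\<close>.\<close>

definition pencil :: "real \<Rightarrow> real \<Rightarrow> real \<Rightarrow> real \<Rightarrow> mat4 set" where
  "pencil a b c d = {gl2_block (r * a + t) (r * b) (r * c) (r * d + t) | r t. True}"

lemma grading_in_pencil: "gl2_block 1 0 0 1 \<in> pencil a b c d"
  unfolding pencil_def by (rule CollectI, rule exI[of _ 0], rule exI[of _ 1]) simp

lemma generator_in_pencil: "gl2_block a b c d \<in> pencil a b c d"
  unfolding pencil_def by (rule CollectI, rule exI[of _ 1], rule exI[of _ 0]) simp

lemma gl2_block_zero: "gl2_block 0 0 0 0 = 0"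
  by (simp add: mat4_eq_iff forall_4 gl2_block_def)

lemma pencil_commute:
  assumes "A \<in> pencil a b c d" "B \<in> pencil a b c d"
  shows "A ** B - B ** A = 0"
proof -
  obtain r t r' t' where AB: "A = gl2_block (r * a + t) (r * b) (r * c) (r * d + t)"
    "B = gl2_block (r' * a + t') (r' * b) (r' * c) (r' * d + t')"
    using assms unfolding pencil_def by blast
  have "A ** B - B ** A = gl2_block 0 0 0 0"
    unfolding AB gl2_block_commutator gl2_block_eq_iff by (intro conjI; algebra)
  then show ?thesis by (simp only: gl2_block_zero)
qed

lemma subspace_pencil: "subspace (pencil a b c d)"
proof (rule subspaceI)
  show "0 \<in> pencil a b c d"
    unfolding pencil_def
    by (rule CollectI, rule exI[of _ 0], rule exI[of _ 0]) (simp add: mat4_eq_iff forall_4 gl2_block_def)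
next
  fix x y assume "x \<in> pencil a b c d" "y \<in> pencil a b c d"
  then obtain r t r' t' where "x = gl2_block (r * a + t) (r * b) (r * c) (r * d + t)"
    "y = gl2_block (r' * a + t') (r' * b) (r' * c) (r' * d + t')"
    unfolding pencil_def by blast
  then have "x + y = gl2_block ((r + r') * a + (t + t')) ((r + r') * b) ((r + r') * c) ((r + r') * d + (t + t'))"
    by (simp add: gl2_block_add algebra_simps)
  then show "x + y \<in> pencil a b c d" unfolding pencil_def by blast
next
  fix k x assume "x \<in> pencil a b c d"
  then obtain r t where "x = gl2_block (r * a + t) (r * b) (r * c) (r * d + t)"
    unfolding pencil_def by blast
  then have "k *\<^sub>R x = gl2_block (k * r * a + k * t) (k * r * b) (k * r * c) (k * r * d + k * t)"
    by (simp add: gl2_block_scaleR algebra_simps)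
  then show "k *\<^sub>R x \<in> pencil a b c d" unfolding pencil_def by blast
qed

lemma pencil_least:
  assumes "subspace W" "gl2_block a b c d \<in> W" "gl2_block s 0 0 s \<in> W" "s \<noteq> 0"
  shows "pencil a b c d \<subseteq> W"
proof -
  have "gl2_block (r * a + t) (r * b) (r * c) (r * d + t)
      = r *\<^sub>R gl2_block a b c d + (t / s) *\<^sub>R gl2_block s 0 0 s" for r t
    using \<open>s \<noteq> 0\<close> by (simp add: gl2_block_add gl2_block_scaleR)
  then show ?thesis
    using assms by (auto simp: pencil_def intro!: subspace_add subspace_scale)
qed

definition normalizer :: "mat4 set \<Rightarrow> mat4 set" where
  "normalizer K = {B \<in> sp_std. \<forall>C\<in>K. B ** C - C ** B \<in> K}"

lemma pencil_subset_normalizer: "pencil a b c d \<subseteq> normalizer (pencil a b c d)"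
proof
  fix B assume B: "B \<in> pencil a b c d"
  then have "B \<in> sp_std" by (auto simp: pencil_def gl2_block_in_sp_std)
  then show "B \<in> normalizer (pencil a b c d)"
    using B subspace_0[OF subspace_pencil] by (auto simp: normalizer_def pencil_commute)
qed

text \<open>Every pencil contains the image of the identity, so the normalizer in \<open>sp(4)\<close> reduces to a normalizer in
\<open>gl(2)\<close>.\<close>

lemma normalizer_pencil_block:
  assumes "B \<in> normalizer (pencil a b c d)"
  obtains a' b' c' d' where "B = gl2_block a' b' c' d'"
proof -
  have "B ** gl2_block 1 0 0 1 - gl2_block 1 0 0 1 ** B \<in> pencil a b c d"
    using assms grading_in_pencil by (auto simp: normalizer_def)
  then show thesis
    using centralizes_grading_imp_gl2_block[of B] assms that
    by (fastforce simp: pencil_def normalizer_def)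
qed

text \<open>The pencil consists of all diagonal matrices, and the commutator of \<open>[[a, b], [c, d]]\<close> with \<open>[[1, 0], [0, 0]]\<close> has
off-diagonal entries \<open>- b\<close> and \<open>c\<close>.\<close>

lemma pencil_real_distinct:
  assumes "\<mu> \<noteq> \<nu>"
  shows "pencil \<mu> 0 0 \<nu> = saddle_saddle_mats" "normalizer (pencil \<mu> 0 0 \<nu>) = pencil \<mu> 0 0 \<nu>"
proof -
  have eq: "gl2_block x 0 0 y \<in> pencil \<mu> 0 0 \<nu>" for x y
  proof -
    define r where "r = (x - y) / (\<mu> - \<nu>)"
    have "r * (\<mu> - \<nu>) = x - y" using assms by (simp add: r_def)
    then have "x = r * \<mu> + (x - r * \<mu>)" "y = r * \<nu> + (x - r * \<mu>)" by (simp_all add: algebra_simps)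
    then have "gl2_block x 0 0 y = gl2_block (r * \<mu> + (x - r * \<mu>)) (r * 0) (r * 0) (r * \<nu> + (x - r * \<mu>))"
      by simp
    then show ?thesis unfolding pencil_def by blast
  qed
  have saddle: "saddle_saddle_mats = {gl2_block (- A) 0 0 (- B) | A B. True}"
    by (simp add: saddle_saddle_mats_def gl2_block_def)
  show "pencil \<mu> 0 0 \<nu> = saddle_saddle_mats"
  proof
    show "saddle_saddle_mats \<subseteq> pencil \<mu> 0 0 \<nu>" using eq by (auto simp: saddle)
    have "\<exists>A B. gl2_block x 0 0 y = gl2_block (- A) 0 0 (- B)" for x y
      by (intro exI[of _ "-x"] exI[of _ "-y"]) simp
    then show "pencil \<mu> 0 0 \<nu> \<subseteq> saddle_saddle_mats" by (auto simp: pencil_def saddle)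
  qed
  have "B \<in> pencil \<mu> 0 0 \<nu>" if B: "B \<in> normalizer (pencil \<mu> 0 0 \<nu>)" for B
  proof -
    obtain a b c d where Beq: "B = gl2_block a b c d" using normalizer_pencil_block[OF B] .
    have "B ** gl2_block 1 0 0 0 - gl2_block 1 0 0 0 ** B \<in> pencil \<mu> 0 0 \<nu>"
      using B eq by (auto simp: normalizer_def)
    then have "b = 0" "c = 0"
      unfolding Beq gl2_block_commutator by (auto simp: pencil_def gl2_block_eq_iff)
    then show ?thesis using eq Beq by simp
  qed
  then show "normalizer (pencil \<mu> 0 0 \<nu>) = pencil \<mu> 0 0 \<nu>"
    using pencil_subset_normalizer by blast
qed

text \<open>The pencil consists of the matrices of complex numbers, and the commutator of \<open>[[a, b], [c, d]]\<close> with the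
matrix of the imaginary unit is symmetric and trace-free.\<close>

lemma pencil_complex:
  assumes "\<kappa> \<noteq> 0"
  shows "pencil \<tau> (- \<kappa>) \<kappa> \<tau> = focus_focus_mats"
    "normalizer (pencil \<tau> (- \<kappa>) \<kappa> \<tau>) = pencil \<tau> (- \<kappa>) \<kappa> \<tau>"
proof -
  have eq: "gl2_block x (- y) y x \<in> pencil \<tau> (- \<kappa>) \<kappa> \<tau>" for x y
  proof -
    define r where "r = y / \<kappa>"
    have "gl2_block x (- y) y x = gl2_block (r * \<tau> + (x - r * \<tau>)) (r * - \<kappa>) (r * \<kappa>) (r * \<tau> + (x - r * \<tau>))"
      using assms by (simp add: r_def)
    then show ?thesis unfolding pencil_def by blast
  qed
  have focus: "focus_focus_mats = {gl2_block (- A) (- B) B (- A) | A B. True}"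
    by (simp add: focus_focus_mats_def gl2_block_def)
  show "pencil \<tau> (- \<kappa>) \<kappa> \<tau> = focus_focus_mats"
  proof
    show "focus_focus_mats \<subseteq> pencil \<tau> (- \<kappa>) \<kappa> \<tau>" using eq by (auto simp: focus)
    have "\<exists>A B. gl2_block x (- y) y x = gl2_block (- A) (- B) B (- A)" for x y
      by (intro exI[of _ "-x"] exI[of _ y]) simp
    then show "pencil \<tau> (- \<kappa>) \<kappa> \<tau> \<subseteq> focus_focus_mats" by (auto simp: pencil_def focus)
  qed
  have "B \<in> pencil \<tau> (- \<kappa>) \<kappa> \<tau>" if B: "B \<in> normalizer (pencil \<tau> (- \<kappa>) \<kappa> \<tau>)" for B
  proof -
    obtain a b c d where Beq: "B = gl2_block a b c d" using normalizer_pencil_block[OF B] .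
    have "B ** gl2_block 0 (- 1) 1 0 - gl2_block 0 (- 1) 1 0 ** B \<in> pencil \<tau> (- \<kappa>) \<kappa> \<tau>"
      using B eq by (auto simp: normalizer_def)
    then have "c = - b" "d = a"
      unfolding Beq gl2_block_commutator by (auto simp: pencil_def gl2_block_eq_iff)
    then show ?thesis using eq[of a "- b"] Beq by simp
  qed
  then show "normalizer (pencil \<tau> (- \<kappa>) \<kappa> \<tau>) = pencil \<tau> (- \<kappa>) \<kappa> \<tau>"
    using pencil_subset_normalizer by blast
qed

text \<open>The matrix \<open>[[0, 0], [0, 1]]\<close> is a grading element for the nilpotent part: its commutator with
\<open>[[0, 0], [\<kappa>, 0]]\<close> is that matrix again. It normalizes the pencil without belonging to it.\<close>

lemma pencil_jordan: "normalizer (pencil \<tau> 0 \<kappa> \<tau>) \<noteq> pencil \<tau> 0 \<kappa> \<tau>"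
proof -
  have "gl2_block 0 0 0 1 \<in> normalizer (pencil \<tau> 0 \<kappa> \<tau>)"
  proof -
    have "gl2_block 0 0 0 1 ** C - C ** gl2_block 0 0 0 1 \<in> pencil \<tau> 0 \<kappa> \<tau>"
      if C: "C \<in> pencil \<tau> 0 \<kappa> \<tau>" for C
    proof -
      obtain r t where Ceq: "C = gl2_block (r * \<tau> + t) 0 (r * \<kappa>) (r * \<tau> + t)"
        using C by (auto simp: pencil_def)
      have "gl2_block 0 0 0 1 ** C - C ** gl2_block 0 0 0 1
          = gl2_block (r * \<tau> + - r * \<tau>) (r * 0) (r * \<kappa>) (r * \<tau> + - r * \<tau>)"
        by (simp add: Ceq gl2_block_commutator)
      then show ?thesis unfolding pencil_def by blast
    qed
    then show ?thesis by (simp add: normalizer_def gl2_block_in_sp_std)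
  qed
  moreover have "gl2_block 0 0 0 1 \<notin> pencil \<tau> 0 \<kappa> \<tau>"
    by (auto simp: pencil_def gl2_block_eq_iff)
  ultimately show ?thesis by blast
qed

section \<open>Transport by a symplectic frame\<close>

text \<open>The columns of \<open>\<Phi>\<close> are the coordinates of a basis of the tangent space in which the orbit form is standard.
Conjugation by such a basis carries all notions of the Lie algebra \<open>sp_orb M\<close> to matrices.\<close>

locale symplectic_frame =
  fixes M :: mat4 and \<Phi> \<Phi>' :: mat4
  assumes tangent: "tangent M = t1_perp"
    and inverse: "\<Phi> ** \<Phi>' = mat 1" "\<Phi>' ** \<Phi> = mat 1"
    and symplectic: "\<And>u v. orb_form M (emb (\<Phi> *v u)) (emb (\<Phi> *v v)) = std_form u v"
begin

definition frame_endo :: "mat4 \<Rightarrow> endo" where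
  "frame_endo B = lift_mat (\<Phi> ** B ** \<Phi>')"

lemma cancel: "\<Phi> *v (\<Phi>' *v u) = u" "\<Phi>' *v (\<Phi> *v u) = u"
  by (simp_all add: matrix_vector_mul_assoc inverse)

lemma frame_endo_apply: "blinfun_apply (frame_endo B) (emb (\<Phi> *v u)) = emb (\<Phi> *v (B *v u))"
  by (simp add: frame_endo_def lift_mat_apply matrix_vector_mul_assoc[symmetric] cancel)

lemma frame_endo_endos: "frame_endo B \<in> endos t1_perp"
  by (simp add: frame_endo_def lift_mat_in_endos)

lemma frame_endo_eqI:
  assumes "A \<in> endos t1_perp" "\<And>u. blinfun_apply A (emb (\<Phi> *v u)) = emb (\<Phi> *v (B *v u))"
  shows "A = frame_endo B"
  by (rule endos_eqI[OF assms(1) frame_endo_endos]) (metis assms(2) frame_endo_apply cancel(1))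

lemma lift_mat_eq_frame_endo: "A ** \<Phi> = \<Phi> ** B \<Longrightarrow> lift_mat A = frame_endo B"
  by (rule frame_endo_eqI[OF lift_mat_in_endos]) (simp add: lift_mat_apply matrix_vector_mul_assoc)

lemma frame_endo_eq_iff: "frame_endo A = frame_endo B \<longleftrightarrow> A = B"
proof
  assume "frame_endo A = frame_endo B"
  then have "emb (\<Phi> *v (A *v u)) = emb (\<Phi> *v (B *v u))" for u
    by (metis frame_endo_apply)
  then have "A *v u = B *v u" for u
    by (metis inj_emb cancel(2))
  then show "A = B" by (simp add: matrix_eq)
qed simp

lemma endos_eq_frame_endo: "endos t1_perp = range frame_endo"
proof -
  have "lift_mat A = frame_endo (\<Phi>' ** A ** \<Phi>)" for A
    by (rule lift_mat_eq_frame_endo) (metis matrix_mul_assoc matrix_mul_lid inverse(1))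
  then show ?thesis unfolding endos_t1_perp frame_endo_def by auto
qed

lemma frame_endo_add: "frame_endo (A + B) = frame_endo A + frame_endo B"
  and frame_endo_scaleR: "frame_endo (c *\<^sub>R A) = c *\<^sub>R frame_endo A"
proof -
  show "frame_endo (A + B) = frame_endo A + frame_endo B"
    by (rule endos_eqI) (auto simp: frame_endo_def lift_mat_add[symmetric] lift_mat_in_endos
        lift_mat_apply matrix_vector_mul_assoc[symmetric] matrix_vector_mult_add_rdistrib
        matrix_vector_right_distrib emb_simps plus_blinfun.rep_eq)
  show "frame_endo (c *\<^sub>R A) = c *\<^sub>R frame_endo A"
    by (rule endos_eqI) (auto simp: frame_endo_def lift_mat_scaleR[symmetric] lift_mat_in_endos
        lift_mat_apply matrix_vector_mul_assoc[symmetric] scaleR_matrix_vector_assoc[symmetric]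
        matrix_vector_mult_scaleR emb_simps scaleR_blinfun.rep_eq)
qed

lemma linear_frame_endo: "linear frame_endo"
  by (rule linearI) (simp_all add: frame_endo_add frame_endo_scaleR)

lemma frame_endo_zero: "frame_endo 0 = 0"
  using linear_frame_endo by (rule linear_0)

lemma comm_frame_endo: "comm (frame_endo A) (frame_endo B) = frame_endo (A ** B - B ** A)"
proof (rule frame_endo_eqI)
  show "comm (frame_endo A) (frame_endo B) \<in> endos t1_perp"
    by (simp add: frame_endo_def comm_lift_mat lift_mat_in_endos)
qed (simp add: comm_def minus_blinfun.rep_eq frame_endo_apply matrix_vector_mult_diff_rdistrib
    matrix_vector_mult_diff_distrib emb_simps matrix_vector_mul_assoc[symmetric])

lemma sp_orb_eq_frame_endo: "sp_orb M = frame_endo ` sp_std"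
proof -
  have *: "(\<forall>u\<in>t1_perp. \<forall>v\<in>t1_perp. orb_form M (blinfun_apply (frame_endo B) u) v
      + orb_form M u (blinfun_apply (frame_endo B) v) = 0) \<longleftrightarrow> B \<in> sp_std" for B
  proof -
    have range: "t1_perp = range (\<lambda>u. emb (\<Phi> *v u))"
      unfolding t1_perp_def by (auto simp: image_iff) (metis cancel(1))
    show ?thesis
      unfolding range by (simp add: sp_std_def frame_endo_apply symplectic)
  qed
  show ?thesis
    unfolding sp_orb_def sp_def tangent endos_eq_frame_endo using * by blast
qed

lemma conjugate_to_frame_endo: "conjugate_to (tangent M) (orb_form M) (frame_endo ` K) K"
  unfolding conjugate_to_def tangent
proof (intro exI conjI)
  let ?\<phi> = "\<lambda>u. emb (\<Phi> *v u)"
  show "linear ?\<phi>"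
    by (intro bounded_linear.linear bounded_linear_compose[OF bounded_linear_emb])
       (rule matrix_vector_mul_bounded_linear)
  have "inj ?\<phi>" by (rule injI) (metis inj_emb cancel(2))
  moreover have "range ?\<phi> = t1_perp"
    unfolding t1_perp_def by (auto simp: image_iff) (metis cancel(1))
  ultimately show "bij_betw ?\<phi> UNIV t1_perp" by (simp add: bij_betw_def)
  show "\<forall>u v. orb_form M (?\<phi> u) (?\<phi> v) = std_form u v" by (simp add: symplectic)
  show "frame_endo ` K = {A \<in> endos t1_perp. \<exists>B\<in>K. \<forall>u. blinfun_apply A (?\<phi> u) = ?\<phi> (B *v u)}"
    using frame_endo_endos frame_endo_apply frame_endo_eqI by blast
qed

lemma frame_endo_pencil_subalgebra: "lie_subalgebra (sp_orb M) (frame_endo ` pencil a b c d)"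
  unfolding lie_subalgebra_def
proof (intro conjI)
  show "subspace (frame_endo ` pencil a b c d)"
    by (rule linear_subspace_image[OF linear_frame_endo subspace_pencil])
  have "pencil a b c d \<subseteq> sp_std" by (auto simp: pencil_def gl2_block_in_sp_std)
  then show "frame_endo ` pencil a b c d \<subseteq> sp_orb M" unfolding sp_orb_eq_frame_endo by (rule image_mono)
  show "\<forall>A\<in>frame_endo ` pencil a b c d. \<forall>B\<in>frame_endo ` pencil a b c d. comm A B \<in> frame_endo ` pencil a b c d"
    using subspace_0[OF subspace_pencil] by (auto simp: comm_frame_endo pencil_commute)
qed

text \<open>The two generators commute, so the algebra that they generate is their span.\<close>

lemma lie_generated_frame_endo:
  assumes "s \<noteq> 0"
  shows "lie_generated (sp_orb M) {frame_endo (gl2_block a b c d), frame_endo (gl2_block s 0 0 s)}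
    = frame_endo ` pencil a b c d"
  unfolding lie_generated_def
proof (rule hull_unique)
  have "s *\<^sub>R gl2_block 1 0 0 1 \<in> pencil a b c d"
    by (intro subspace_scale subspace_pencil grading_in_pencil)
  then show "{frame_endo (gl2_block a b c d), frame_endo (gl2_block s 0 0 s)} \<subseteq> frame_endo ` pencil a b c d"
    using generator_in_pencil by (auto simp: gl2_block_scaleR)
  show "lie_subalgebra (sp_orb M) (frame_endo ` pencil a b c d)" by (rule frame_endo_pencil_subalgebra)
  fix h assume h: "{frame_endo (gl2_block a b c d), frame_endo (gl2_block s 0 0 s)} \<subseteq> h" "lie_subalgebra (sp_orb M) h"
  have "subspace {B. frame_endo B \<in> h}"
    using linear_subspace_vimage[OF linear_frame_endo, of h] h(2) by (simp add: lie_subalgebra_def vimage_def)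
  then have "pencil a b c d \<subseteq> {B. frame_endo B \<in> h}"
    using h(1) assms by (intro pencil_least[of _ _ _ _ _ s]) auto
  then show "frame_endo ` pencil a b c d \<subseteq> h" by blast
qed

text \<open>A pencil is abelian, so nilpotency is automatic and only self-normalization has to be decided.\<close>

lemma cartan_frame_endo_pencil:
  "cartan_subalgebra (sp_orb M) (frame_endo ` pencil a b c d)
    \<longleftrightarrow> normalizer (pencil a b c d) = pencil a b c d"
proof -
  let ?h = "frame_endo ` pencil a b c d"
  have "{comm A B | A B. A \<in> ?h \<and> B \<in> ?h} = {0}"
  proof
    show "{comm A B | A B. A \<in> ?h \<and> B \<in> ?h} \<subseteq> {0}"
      by (auto simp: comm_frame_endo pencil_commute frame_endo_zero)
    have "comm 0 0 = 0" "0 \<in> ?h"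
      using subspace_0[OF linear_subspace_image[OF linear_frame_endo subspace_pencil]]
      by (simp_all add: comm_def)
    then show "{0} \<subseteq> {comm A B | A B. A \<in> ?h \<and> B \<in> ?h}" by force
  qed
  then have "lower_central ?h (Suc 0) = {0}" by simp
  then have nilpotent: "\<exists>n. lower_central ?h n = {0}" by (rule exI)
  have inj: "inj frame_endo" by (rule injI) (simp add: frame_endo_eq_iff)
  have "{A \<in> sp_orb M. \<forall>B\<in>?h. comm A B \<in> ?h} = frame_endo ` normalizer (pencil a b c d)"
    unfolding sp_orb_eq_frame_endo normalizer_def
    by (auto simp: comm_frame_endo inj_image_mem_iff[OF inj])
  then show ?thesis
    using nilpotent frame_endo_pencil_subalgebra
    by (simp only: cartan_subalgebra_def inj_image_eq_iff[OF inj] simp_thms)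
qed

end

section \<open>A symplectic frame for the resonant linearization\<close>

text \<open>The shape of the linearizations of \<open>H\<close> and \<open>I\<close>. For \<open>H\<close> the coefficients \<open>A, B, C, D\<close> are given in
\<open>resonance_ratio\<close>; for \<open>I\<close> all four are \<open>- 2\<close>.\<close>

definition res_mat :: "real \<Rightarrow> real \<Rightarrow> real \<Rightarrow> real \<Rightarrow> real \<Rightarrow> real \<Rightarrow> real \<Rightarrow> real \<Rightarrow> mat4" where
  "res_mat p q m n A B C D = vector
    [vector [0, 0, m * (p * A), - (m * (q * B))],
     vector [0, 0, m * (q * C), - (m * (p * D))],
     vector [- (n * (p * A)), n * (q * C), 0, 0],
     vector [- (n * (q * B)), n * (p * D), 0, 0]]"

text \<open>The vector \<open>(\<xi>, \<rho> T \<xi>)\<close> for \<open>\<xi> = (z, w)\<close>. The signs \<open>\<plusminus> \<rho>\<close> give the two invariant Lagrangian planes.\<close>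

definition eigen_vec :: "real \<Rightarrow> real \<Rightarrow> real \<Rightarrow> real \<Rightarrow> real \<Rightarrow> real^4" where
  "eigen_vec p q \<rho> z w = vector [z, w, \<rho> * (p * z - q * w), \<rho> * (q * z - p * w)]"

text \<open>Both planes are invariant: this is where \<open>A + D = B + C\<close>, the condition for the linearizations of \<open>H\<close> and \<open>I\<close>
to commute, enters. The matrix acting on \<open>\<xi>\<close> is \<open>N\<close>.\<close>

lemma res_mat_eigen_vec:
  assumes "n = \<rho>\<^sup>2 * m * (q\<^sup>2 - p\<^sup>2)" "A + D = B + C"
  shows "res_mat p q m n A B C D *v eigen_vec p q \<rho> z w = (\<rho> * m) *\<^sub>R
    eigen_vec p q \<rho> ((p\<^sup>2 * A - q\<^sup>2 * B) * z + p * q * (B - A) * w) (- (p * q * (B - A)) * z + (p\<^sup>2 * D - q\<^sup>2 * C) * w)"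
proof -
  have D: "D = B + C - A" using assms(2) by simp
  show ?thesis
    unfolding D assms(1)
    by (simp add: vec_eq_iff forall_4 eigen_vec_def res_mat_def matrix_vector_mult_def sum_4
        power2_eq_square algebra_simps)
qed

text \<open>The first two columns span the plane for \<open>\<rho>\<close> in the basis \<open>(a1, a2), (b1, b2)\<close>. The other two
columns are, up to a scalar, the dual basis of the plane for \<open>- \<rho>\<close>; the normalization \<open>2 \<rho> (a1 b2 - a2 b1) = 1\<close> makes the scalar one.\<close>

definition frame_mat :: "real \<Rightarrow> real \<Rightarrow> real \<Rightarrow> real \<Rightarrow> real \<Rightarrow> real \<Rightarrow> real \<Rightarrow> mat4" where
  "frame_mat p q \<rho> a1 a2 b1 b2 = transpose (vector
    [eigen_vec p q \<rho> a1 a2, eigen_vec p q \<rho> b1 b2, eigen_vec p q (- \<rho>) b2 b1, eigen_vec p q (- \<rho>) (- a2) (- a1)])"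

lemma frame_mat_mult:
  "frame_mat p q \<rho> a1 a2 b1 b2 *v u =
     eigen_vec p q \<rho> (a1 * u$1 + b1 * u$2) (a2 * u$1 + b2 * u$2)
   + eigen_vec p q (- \<rho>) (b2 * u$3 - a2 * u$4) (b1 * u$3 - a1 * u$4)"
  by (simp add: frame_mat_def vec_eq_iff forall_4 matrix_vector_mult_def sum_4 transpose_def eigen_vec_def algebra_simps)

text \<open>The two planes are Lagrangian, and they are paired by \<open>2 \<rho> diag(1, - 1)\<close>.\<close>

lemma perp_form_eigen_vec:
  assumes "p\<^sup>2 \<noteq> q\<^sup>2"
  shows "perp_form p q (eigen_vec p q \<rho> z w + eigen_vec p q (- \<rho>) z' w') (eigen_vec p q \<rho> x y + eigen_vec p q (- \<rho>) x' y')
    = 2 * \<rho> * (z * x' - w * y' - z' * x + w' * y)"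
proof -
  define c where "c = 1 / (q\<^sup>2 - p\<^sup>2)"
  have c: "c * (q\<^sup>2 - p\<^sup>2) = 1" using assms by (simp add: c_def)
  show ?thesis
    unfolding perp_form_def ad_perp_inv_def c_def[symmetric] inner_vec_def sum_4 eigen_vec_def
      vector_4_nth vector_scaleR_component vector_add_component real_scaleR_def inner_real_def
    using c by algebra
qed

lemma frame_mat_symplectic:
  assumes "p\<^sup>2 \<noteq> q\<^sup>2" "2 * \<rho> * (a1 * b2 - a2 * b1) = 1"
  shows "perp_form p q (frame_mat p q \<rho> a1 a2 b1 b2 *v u) (frame_mat p q \<rho> a1 a2 b1 b2 *v v) = std_form u v"
  unfolding frame_mat_mult perp_form_eigen_vec[OF assms(1)] std_form_def
  using assms(2) by algebra

lemma symplectic_imp_invertible: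
  assumes "\<And>u v. \<omega> (\<Phi> *v u) (\<Phi> *v v) = std_form u v" "\<And>v. \<omega> 0 v = 0"
  obtains \<Phi>' :: mat4 where "\<Phi> ** \<Phi>' = mat 1" "\<Phi>' ** \<Phi> = mat 1"
proof -
  have "u = 0" if u: "\<Phi> *v u = 0" for u
  proof -
    have *: "std_form u v = 0" for v
      using assms u by metis
    show ?thesis
      using *[of "axis 1 1"] *[of "axis 2 1"] *[of "axis 3 1"] *[of "axis 4 1"]
      by (simp add: std_form_def axis_def vec_eq_iff forall_4)
  qed
  then have "\<exists>\<Phi>'. \<Phi>' ** \<Phi> = mat 1"
    unfolding matrix_left_invertible_ker by blast
  then show thesis
    using that matrix_left_right_inverse by blast
qed

text \<open>If \<open>N U = U X\<close> for the matrix \<open>U\<close> of the basis, the first plane carries \<open>\<rho> m X\<close>. On the second plane the linear map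
is \<open>- \<rho> m N\<close>, which has the matrix \<open>- \<rho> m X\<^sup>T\<close> in the dual basis because \<open>diag(1, - 1) N\<^sup>T diag(1, - 1) = N\<close>.\<close>

lemma res_mat_frame_mat:
  assumes n: "n = \<rho>\<^sup>2 * m * (q\<^sup>2 - p\<^sup>2)" and AD: "A + D = B + C"
    and \<Delta>: "2 * \<rho> * (a1 * b2 - a2 * b1) = 1"
    and g: "g = p\<^sup>2 * A - q\<^sup>2 * B" and h: "h = p\<^sup>2 * D - q\<^sup>2 * C" and f: "f = p * q * (B - A)"
    and a: "g * a1 + f * a2 = x * a1 + z * b1" "- f * a1 + h * a2 = x * a2 + z * b2"
    and b: "g * b1 + f * b2 = y * a1 + w * b1" "- f * b1 + h * b2 = y * a2 + w * b2"
  shows "res_mat p q m n A B C D ** frame_mat p q \<rho> a1 a2 b1 b2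
    = frame_mat p q \<rho> a1 a2 b1 b2 ** gl2_block (\<rho> * m * x) (\<rho> * m * y) (\<rho> * m * z) (\<rho> * m * w)"
proof -
  \<comment> \<open>The equations for the dual basis follow from \<open>adj(U) N = X adj(U)\<close>, since \<open>U\<close> is invertible.\<close>
  have dual: "g * b2 + f * b1 = x * b2 - y * a2" "- f * b2 + h * b1 = x * b1 - y * a1"
     "- g * a2 - f * a1 = z * b2 - w * a2" "f * a2 - h * a1 = z * b1 - w * a1"
    using \<Delta> a b by algebra+
  have n': "n = (- \<rho>)\<^sup>2 * m * (q\<^sup>2 - p\<^sup>2)" using n by simp
  have "res_mat p q m n A B C D *v (frame_mat p q \<rho> a1 a2 b1 b2 *v u)
    = frame_mat p q \<rho> a1 a2 b1 b2 *v (gl2_block (\<rho> * m * x) (\<rho> * m * y) (\<rho> * m * z) (\<rho> * m * w) *v u)" for u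
  proof -
    have E: "gl2_block (\<rho> * m * x) (\<rho> * m * y) (\<rho> * m * z) (\<rho> * m * w) *v u =
      vector [\<rho> * m * x * u$1 + \<rho> * m * y * u$2, \<rho> * m * z * u$1 + \<rho> * m * w * u$2,
        - (\<rho> * m * x) * u$3 - \<rho> * m * z * u$4, - (\<rho> * m * y) * u$3 - \<rho> * m * w * u$4]"
      by (simp add: vec_eq_iff forall_4 gl2_block_def matrix_vector_mult_def sum_4)
    have 1: "g * (a1 * u$1 + b1 * u$2) + f * (a2 * u$1 + b2 * u$2) = (x * a1 + z * b1) * u$1 + (y * a1 + w * b1) * u$2"
      "- f * (a1 * u$1 + b1 * u$2) + h * (a2 * u$1 + b2 * u$2) = (x * a2 + z * b2) * u$1 + (y * a2 + w * b2) * u$2"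
      "g * (b2 * u$3 - a2 * u$4) + f * (b1 * u$3 - a1 * u$4) = (x * b2 - y * a2) * u$3 + (z * b2 - w * a2) * u$4"
      "- f * (b2 * u$3 - a2 * u$4) + h * (b1 * u$3 - a1 * u$4) = (x * b1 - y * a1) * u$3 + (z * b1 - w * a1) * u$4"
      using a b dual by algebra+
    show ?thesis
      unfolding E frame_mat_mult matrix_vector_right_distrib res_mat_eigen_vec[OF n AD] res_mat_eigen_vec[OF n' AD]
        g[symmetric] h[symmetric] f[symmetric] 1 vector_4_nth
      by (simp add: eigen_vec_def vec_eq_iff forall_4 algebra_simps)
  qed
  then show ?thesis
    by (simp add: matrix_eq matrix_vector_mul_assoc[symmetric])
qed

section \<open>Normal forms of two by two matrices\<close>

text \<open>Eigenvectors \<open>(1, k)\<close> and \<open>(k, 1)\<close> belong to the same root \<open>k\<close> of \<open>f k\<^sup>2 + (g - h) k + f\<close>. The discriminant condition says that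
this polynomial has opposite signs at \<open>- 1\<close> and \<open>1\<close>, so there is a root with \<open>\<bar>k\<bar> < 1\<close>; this also covers \<open>f = 0\<close> and gives the determinant
\<open>1 - k\<^sup>2\<close> its sign. The factor \<open>r\<close> only normalizes the determinant.\<close>

lemma real_eigenbasis:
  fixes g f h \<rho> :: real
  assumes "4 * f\<^sup>2 < (g - h)\<^sup>2" "0 < \<rho>"
  obtains a1 a2 b1 b2 x w where "2 * \<rho> * (a1 * b2 - a2 * b1) = 1" "x \<noteq> w"
    "g * a1 + f * a2 = x * a1" "- f * a1 + h * a2 = x * a2"
    "g * b1 + f * b2 = w * b1" "- f * b1 + h * b2 = w * b2"
proof -
  define P where "P k = f * k\<^sup>2 + (g - h) * k + f" for k
  have opp: "P (- 1) * P 1 < 0"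
    using assms(1) by (simp add: P_def power2_eq_square algebra_simps)
  have cont: "\<And>k. isCont P k" unfolding P_def by (intro continuous_intros)
  have "\<exists>k. - 1 \<le> k \<and> k \<le> 1 \<and> P k = 0"
  proof (cases "P (- 1) \<le> 0")
    case True
    then have "0 \<le> P 1" using opp by (metis mult_nonpos_nonpos not_le nless_le)
    then show ?thesis using True cont by (intro IVT) auto
  next
    case False
    then have "P 1 \<le> 0" using opp by (smt (verit) mult_nonneg_nonneg)
    then show ?thesis using False cont by (intro IVT2) auto
  qed
  then obtain k where k: "- 1 \<le> k" "k \<le> 1" "P k = 0" by blast
  have "k \<noteq> 1" "k \<noteq> - 1" using k(3) opp by auto
  then have "\<bar>k\<bar> < 1" using k by linarith
  then have k1: "k\<^sup>2 < 1" by (simp add: abs_square_less_1)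
  have Pk: "f * k\<^sup>2 + (g - h) * k + f = 0" using k(3) by (simp add: P_def)
  define r where "r = sqrt (1 / (2 * \<rho> * (1 - k\<^sup>2)))"
  have r2: "2 * \<rho> * (1 - k\<^sup>2) * r\<^sup>2 = 1"
    using k1 assms(2) by (simp add: r_def)
  show thesis
  proof (rule that[of r r "r * k" "r * k" "g + f * k" "h - f * k"])
    show "2 * \<rho> * (r * r - r * k * (r * k)) = 1"
      using r2 by algebra
    have "(g - h + 2 * f * k)\<^sup>2 = (g - h)\<^sup>2 - 4 * f\<^sup>2"
      using Pk by algebra
    then show "g + f * k \<noteq> h - f * k" using assms(1) by auto
  qed (insert Pk, (algebra | simp add: algebra_simps)+)
qed

text \<open>With \<open>\<tau> = tr N / 2\<close>, the trace-free part satisfies \<open>(N - \<tau>)\<^sup>2 = - \<kappa>\<^sup>2 Id\<close>. Hence a vector \<open>v\<close> and \<open>(N - \<tau>) v / \<kappa>\<close>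
form the required basis; \<open>v = (r, 0)\<close> is taken. The sign of \<open>\<kappa>\<close> makes the determinant positive.\<close>

lemma rotation_basis:
  fixes g f h \<rho> :: real
  assumes "(g - h)\<^sup>2 < 4 * f\<^sup>2" "0 < \<rho>"
  obtains a1 a2 b1 b2 \<tau> \<kappa> where "2 * \<rho> * (a1 * b2 - a2 * b1) = 1" "\<kappa> \<noteq> 0"
    "g * a1 + f * a2 = \<tau> * a1 + \<kappa> * b1" "- f * a1 + h * a2 = \<tau> * a2 + \<kappa> * b2"
    "g * b1 + f * b2 = - \<kappa> * a1 + \<tau> * b1" "- f * b1 + h * b2 = - \<kappa> * a2 + \<tau> * b2"
proof -
  define \<kappa> where "\<kappa> = - sgn f * sqrt (f\<^sup>2 - (g - h)\<^sup>2 / 4)"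
  have f: "f \<noteq> 0" using assms(1) zero_le_power2[of "g - h"] by fastforce
  have \<kappa>2: "\<kappa>\<^sup>2 = f\<^sup>2 - (g - h)\<^sup>2 / 4"
    using assms(1) f by (simp add: \<kappa>_def power_mult_distrib sgn_if)
  have sgn: "0 < - f / \<kappa>"
    using f assms(1) by (auto simp: \<kappa>_def sgn_if zero_less_divide_iff)
  then have \<kappa>: "\<kappa> \<noteq> 0" by auto
  define s where "s = - f / \<kappa>"
  define r where "r = sqrt (1 / (2 * \<rho> * s))"
  have "2 * \<rho> * (r\<^sup>2 * s) = 1"
    using sgn assms(2) unfolding s_def[symmetric] by (simp add: r_def)
  then have r2: "2 * \<rho> * (r\<^sup>2 * (- f / \<kappa>)) = 1" by (simp only: s_def)
  define e where "e = r / \<kappa>"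
  have r: "r = \<kappa> * e" using \<kappa> by (simp add: e_def)
  define \<tau> where "\<tau> = (g + h) / 2"
  define \<delta> where "\<delta> = (g - h) / 2"
  have gh: "g = \<tau> + \<delta>" "h = \<tau> - \<delta>" by (simp_all add: \<tau>_def \<delta>_def field_simps)
  have \<kappa>\<delta>: "\<kappa>\<^sup>2 = f\<^sup>2 - \<delta>\<^sup>2" by (simp add: \<kappa>2 \<delta>_def power_divide)
  show thesis
  proof (rule that[of r "- f * e" 0 "\<delta> * e" \<kappa> \<tau>])
    show "2 * \<rho> * (r * (- f * e) - 0 * (\<delta> * e)) = 1"
      using r2 by (simp add: e_def power2_eq_square ac_simps)
  qed (insert \<kappa> \<kappa>\<delta> r gh, assumption | algebra)+
qed

text \<open>Here \<open>N - \<tau>\<close> is nilpotent, with \<open>\<tau> = tr N / 2\<close>, and the basis is \<open>v = (r, 0)\<close> together with \<open>(N - \<tau>) v / (- f)\<close>.\<close>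

lemma jordan_basis:
  fixes g f h \<rho> :: real
  assumes "(g - h)\<^sup>2 = 4 * f\<^sup>2" "0 < \<rho>" "f \<noteq> 0"
  obtains a1 a2 b1 b2 \<tau> where "2 * \<rho> * (a1 * b2 - a2 * b1) = 1"
    "g * a1 + f * a2 = \<tau> * a1 - f * b1" "- f * a1 + h * a2 = \<tau> * a2 - f * b2"
    "g * b1 + f * b2 = \<tau> * b1" "- f * b1 + h * b2 = \<tau> * b2"
proof -
  define r where "r = sqrt (1 / (2 * \<rho>))"
  have r2: "2 * \<rho> * r\<^sup>2 = 1" using assms(2) by (simp add: r_def)
  define \<tau> where "\<tau> = (g + h) / 2"
  define e where "e = (g - h) / 2 / f"
  have gh: "g = \<tau> + e * f" "h = \<tau> - e * f"
    using assms(3) by (simp_all add: \<tau>_def e_def field_simps)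
  then have "e\<^sup>2 * f\<^sup>2 = 1 * f\<^sup>2" using assms(1) by algebra
  then have e2: "e\<^sup>2 = 1" using assms(3) by simp
  show thesis
  proof (rule that[of r r 0 "- r * e" \<tau>])
    show "2 * \<rho> * (r * r - 0 * (- r * e)) = 1" using r2 by (simp add: power2_eq_square)
  qed (insert gh e2, (algebra | simp add: algebra_simps)+)
qed

text \<open>The value of \<open>\<rho>\<close> is the one for which \<open>n = \<rho>\<^sup>2 m (q\<^sup>2 - p\<^sup>2)\<close>, that is, for which the planes \<open>\<eta> = \<plusminus> \<rho> T \<xi>\<close> are the eigenspaces of the
linearization of \<open>I\<close>. The eigenvalue is \<open>2 \<rho> m (q\<^sup>2 - p\<^sup>2)\<close>.\<close>

lemma resonant_linearization_algebra:
  assumes mn: "0 < m" "0 < n" and pq: "p\<^sup>2 < q\<^sup>2" and AD: "A + D = B + C"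
    and \<rho>: "\<rho> = sqrt (n / (m * (q\<^sup>2 - p\<^sup>2)))"
    and basis: "2 * \<rho> * (a1 * b2 - a2 * b1) = 1"
    and g: "g = p\<^sup>2 * A - q\<^sup>2 * B" and h: "h = p\<^sup>2 * D - q\<^sup>2 * C" and f: "f = p * q * (B - A)"
    and a: "g * a1 + f * a2 = x * a1 + z * b1" "- f * a1 + h * a2 = x * a2 + z * b2"
    and b: "g * b1 + f * b2 = y * a1 + w * b1" "- f * b1 + h * b2 = y * a2 + w * b2"
    and K: "K = pencil (\<rho> * m * x) (\<rho> * m * y) (\<rho> * m * z) (\<rho> * m * w)"
    and L: "L = lie_generated (sp_orb (M1 p q))
      {lift_mat (res_mat p q m n A B C D), lift_mat (res_mat p q m n (- 2) (- 2) (- 2) (- 2))}"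
  shows "cartan_subalgebra (sp_orb (M1 p q)) L \<longleftrightarrow> normalizer K = K"
    and "conjugate_to (tangent (M1 p q)) (orb_form (M1 p q)) L K"
proof -
  define \<Phi> where "\<Phi> = frame_mat p q \<rho> a1 a2 b1 b2"
  have neq: "p\<^sup>2 \<noteq> q\<^sup>2" using pq by simp
  have \<rho>2: "\<rho>\<^sup>2 = n / (m * (q\<^sup>2 - p\<^sup>2))"
    unfolding \<rho> using mn pq by (intro real_sqrt_pow2) auto
  then have n: "n = \<rho>\<^sup>2 * m * (q\<^sup>2 - p\<^sup>2)"
    using mn pq by (simp add: mult.assoc)
  have \<rho>0: "0 < \<rho>"
    unfolding \<rho> using mn pq by simp
  have symp: "perp_form p q (\<Phi> *v u) (\<Phi> *v v) = std_form u v" for u v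
    unfolding \<Phi>_def by (rule frame_mat_symplectic[OF neq basis])
  obtain \<Phi>' where inv: "\<Phi> ** \<Phi>' = mat 1" "\<Phi>' ** \<Phi> = mat 1"
    using symplectic_imp_invertible[of "perp_form p q" \<Phi>] symp by (auto simp: perp_form_def)
  interpret symplectic_frame "M1 p q" \<Phi> \<Phi>'
    by unfold_locales (simp_all add: inv tangent_M1 neq orb_form_M1 symp)
  have H: "lift_mat (res_mat p q m n A B C D)
      = frame_endo (gl2_block (\<rho> * m * x) (\<rho> * m * y) (\<rho> * m * z) (\<rho> * m * w))"
    unfolding \<Phi>_def[symmetric]
    by (rule lift_mat_eq_frame_endo) (unfold \<Phi>_def, rule res_mat_frame_mat[OF n AD basis g h f a b])
  define s where "s = \<rho> * m * (2 * (q\<^sup>2 - p\<^sup>2))"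
  have "s \<noteq> 0" using \<rho>0 mn pq by (simp add: s_def)
  have I: "lift_mat (res_mat p q m n (- 2) (- 2) (- 2) (- 2)) = frame_endo (gl2_block s 0 0 s)"
  proof (rule lift_mat_eq_frame_endo)
    have "res_mat p q m n (- 2) (- 2) (- 2) (- 2) ** frame_mat p q \<rho> a1 a2 b1 b2
        = frame_mat p q \<rho> a1 a2 b1 b2
          ** gl2_block s (\<rho> * m * 0) (\<rho> * m * 0) s"
      unfolding s_def
      by (rule res_mat_frame_mat[OF n _ basis refl refl refl]) algebra+
    then show "res_mat p q m n (- 2) (- 2) (- 2) (- 2) ** \<Phi> = \<Phi> ** gl2_block s 0 0 s"
      by (simp add: \<Phi>_def)
  qed
  have LK: "L = frame_endo ` K"
    unfolding L H I K by (rule lie_generated_frame_endo) fact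
  show "cartan_subalgebra (sp_orb (M1 p q)) L \<longleftrightarrow> normalizer K = K"
    unfolding LK unfolding K by (rule cartan_frame_endo_pencil)
  show "conjugate_to (tangent (M1 p q)) (orb_form (M1 p q)) L K"
    unfolding LK by (rule conjugate_to_frame_endo)
qed

theorem resonant_type:
  assumes mn: "0 < m" "0 < n" and pq: "p\<^sup>2 < q\<^sup>2" and AD: "A + D = B + C"
    and g: "g = p\<^sup>2 * A - q\<^sup>2 * B" and h: "h = p\<^sup>2 * D - q\<^sup>2 * C" and f: "f = p * q * (B - A)"
    and L: "L = lie_generated (sp_orb (M1 p q))
      {lift_mat (res_mat p q m n A B C D), lift_mat (res_mat p q m n (- 2) (- 2) (- 2) (- 2))}"
  shows "4 * f\<^sup>2 < (g - h)\<^sup>2 \<Longrightarrow> cartan_subalgebra (sp_orb (M1 p q)) L \<and>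
      conjugate_to (tangent (M1 p q)) (orb_form (M1 p q)) L saddle_saddle_mats"
    and "(g - h)\<^sup>2 < 4 * f\<^sup>2 \<Longrightarrow> cartan_subalgebra (sp_orb (M1 p q)) L \<and>
      conjugate_to (tangent (M1 p q)) (orb_form (M1 p q)) L focus_focus_mats"
    and "(g - h)\<^sup>2 = 4 * f\<^sup>2 \<Longrightarrow> f \<noteq> 0 \<Longrightarrow> \<not> cartan_subalgebra (sp_orb (M1 p q)) L"
proof -
  define \<rho> where "\<rho> = sqrt (n / (m * (q\<^sup>2 - p\<^sup>2)))"
  have \<rho>0: "0 < \<rho>" unfolding \<rho>_def using mn pq by simp
  have nz: "\<rho> * m \<noteq> 0" using \<rho>0 mn by simp
  note * = resonant_linearization_algebra[OF mn pq AD \<rho>_def _ g h f _ _ _ _ _ L]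
  show "cartan_subalgebra (sp_orb (M1 p q)) L \<and>
      conjugate_to (tangent (M1 p q)) (orb_form (M1 p q)) L saddle_saddle_mats"
    if cond: "4 * f\<^sup>2 < (g - h)\<^sup>2"
  proof -
    obtain a1 a2 b1 b2 x w where B: "2 * \<rho> * (a1 * b2 - a2 * b1) = 1" "x \<noteq> w"
      "g * a1 + f * a2 = x * a1" "- f * a1 + h * a2 = x * a2"
      "g * b1 + f * b2 = w * b1" "- f * b1 + h * b2 = w * b2"
      using real_eigenbasis[OF cond \<rho>0] by metis
    have B': "g * a1 + f * a2 = x * a1 + 0 * b1" "- f * a1 + h * a2 = x * a2 + 0 * b2"
      "g * b1 + f * b2 = 0 * a1 + w * b1" "- f * b1 + h * b2 = 0 * a2 + w * b2"
      using B by auto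
    define K where "K = pencil (\<rho> * m * x) (\<rho> * m * 0) (\<rho> * m * 0) (\<rho> * m * w)"
    have "\<rho> * m * x \<noteq> \<rho> * m * w" using B(2) nz by simp
    then have "K = saddle_saddle_mats" "normalizer K = K"
      using pencil_real_distinct[of "\<rho> * m * x" "\<rho> * m * w"] by (simp_all add: K_def)
    moreover have "cartan_subalgebra (sp_orb (M1 p q)) L \<longleftrightarrow> normalizer K = K"
      "conjugate_to (tangent (M1 p q)) (orb_form (M1 p q)) L K"
      using *[OF B(1) B' K_def] by blast+
    ultimately show ?thesis by simp
  qed
  show "cartan_subalgebra (sp_orb (M1 p q)) L \<and>
      conjugate_to (tangent (M1 p q)) (orb_form (M1 p q)) L focus_focus_mats"
    if cond: "(g - h)\<^sup>2 < 4 * f\<^sup>2"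
  proof -
    obtain a1 a2 b1 b2 \<tau> \<kappa> where B: "2 * \<rho> * (a1 * b2 - a2 * b1) = 1" "\<kappa> \<noteq> 0"
      "g * a1 + f * a2 = \<tau> * a1 + \<kappa> * b1" "- f * a1 + h * a2 = \<tau> * a2 + \<kappa> * b2"
      "g * b1 + f * b2 = - \<kappa> * a1 + \<tau> * b1" "- f * b1 + h * b2 = - \<kappa> * a2 + \<tau> * b2"
      using rotation_basis[OF cond \<rho>0] by metis
    define K where "K = pencil (\<rho> * m * \<tau>) (\<rho> * m * - \<kappa>) (\<rho> * m * \<kappa>) (\<rho> * m * \<tau>)"
    have "\<rho> * m * \<kappa> \<noteq> 0" using B(2) nz by simp
    then have "K = focus_focus_mats" "normalizer K = K"
      using pencil_complex[of "\<rho> * m * \<kappa>" "\<rho> * m * \<tau>"] by (simp_all add: K_def)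
    moreover have "cartan_subalgebra (sp_orb (M1 p q)) L \<longleftrightarrow> normalizer K = K"
      "conjugate_to (tangent (M1 p q)) (orb_form (M1 p q)) L K"
      using *[OF B(1) B(3-) K_def] by blast+
    ultimately show ?thesis by simp
  qed
  show "\<not> cartan_subalgebra (sp_orb (M1 p q)) L" if cond: "(g - h)\<^sup>2 = 4 * f\<^sup>2" "f \<noteq> 0"
  proof -
    obtain a1 a2 b1 b2 \<tau> where B: "2 * \<rho> * (a1 * b2 - a2 * b1) = 1"
      "g * a1 + f * a2 = \<tau> * a1 - f * b1" "- f * a1 + h * a2 = \<tau> * a2 - f * b2"
      "g * b1 + f * b2 = \<tau> * b1" "- f * b1 + h * b2 = \<tau> * b2"
      using jordan_basis[OF cond(1) \<rho>0 cond(2)] by metis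
    have B': "g * a1 + f * a2 = \<tau> * a1 + - f * b1" "- f * a1 + h * a2 = \<tau> * a2 + - f * b2"
      "g * b1 + f * b2 = 0 * a1 + \<tau> * b1" "- f * b1 + h * b2 = 0 * a2 + \<tau> * b2"
      using B by auto
    define K where "K = pencil (\<rho> * m * \<tau>) (\<rho> * m * 0) (\<rho> * m * - f) (\<rho> * m * \<tau>)"
    have "cartan_subalgebra (sp_orb (M1 p q)) L \<longleftrightarrow> normalizer K = K"
      using *(1)[OF B(1) B' K_def] .
    then show ?thesis
      using pencil_jordan[of "\<rho> * m * \<tau>" "\<rho> * m * - f"] by (simp add: K_def)
  qed
qed

section \<open>Solutions and nearby points on the orbit\<close>

text \<open>The field is quadratic in \<open>(x, y)\<close>, and both Casimirs are preserved because the cross product is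
alternating. Preservation of \<open>C1\<close> is the hypothesis of \<open>quadratic_ode_global_solution\<close>.\<close>

lemma rigid_flow_exists:
  assumes X: "\<And>N. N \<in> so4 \<Longrightarrow> X N = lie N (diag_op k l N)" and M: "M \<in> Orb c1 c2"
  obtains \<gamma> where "solution_in (Orb c1 c2) X \<gamma>" "\<gamma> 0 = M"
proof -
  define B :: "(real^3) \<times> (real^3) \<Rightarrow> (real^3) \<times> (real^3) \<Rightarrow> (real^3) \<times> (real^3)" where
    "B z z' = (cross3 (fst z) (k * fst z') + cross3 (snd z) (l * snd z'),
               cross3 (fst z) (l * snd z') + cross3 (snd z) (k * fst z'))" for z z'
  have bil: "bounded_bilinear B"
    by (intro bilinear_conv_bounded_bilinear[THEN iffD1])
       (auto simp: bilinear_def B_def cross_add_left cross_add_right cross_mult_left cross_mult_right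
          distrib_left scaleR_add_right intro!: linearI)
  have trip: "a \<bullet> cross3 a b = 0" "a \<bullet> cross3 b c + b \<bullet> cross3 a c = 0" for a b c :: "real^3"
    by (simp_all add: cross3_simps)
  have orth: "z \<bullet> B z z = 0" for z
    using trip(2)[of "fst z" "snd z" "l * snd z"]
    by (simp add: B_def inner_prod_def inner_add_right trip(1))
  have orth2: "fst z \<bullet> snd (B z z) + fst (B z z) \<bullet> snd z = 0" for z
    using trip(2)[of "fst z" "snd z" "k * fst z"]
    by (simp add: B_def inner_add_right inner_add_left trip(1) inner_commute[of _ "snd z"])
  obtain x0 y0 where M0: "M = so4_mat x0 y0"
    using M so4_cases unfolding Orb_def by blast
  obtain \<zeta> where \<zeta>: "\<zeta> 0 = (x0, y0)"
    "\<And>t. 0 \<le> t \<Longrightarrow> (\<zeta> has_vector_derivative B (\<zeta> t) (\<zeta> t)) (at t within {0..})"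
    using quadratic_ode_global_solution[OF bil orth] by metis
  define \<gamma> where "\<gamma> t = so4_mat (fst (\<zeta> t)) (snd (\<zeta> t))" for t
  have X\<gamma>: "X (\<gamma> t) = so4_mat (fst (B (\<zeta> t) (\<zeta> t))) (snd (B (\<zeta> t) (\<zeta> t)))" for t
    by (simp add: X \<gamma>_def diag_op_def xc_so4_mat yc_so4_mat lie_so4_mat B_def)
  have d\<gamma>: "(\<gamma> has_vector_derivative X (\<gamma> t)) (at t within {0..})" if "0 \<le> t" for t
    unfolding X\<gamma> unfolding \<gamma>_def
    using bounded_linear.has_vector_derivative[OF bounded_linear_so4_mat \<zeta>(2)[OF that]] .
  have c1: "\<zeta> t \<bullet> \<zeta> t = \<zeta> 0 \<bullet> \<zeta> 0" if "0 \<le> t" for t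
  proof (rule has_vector_derivative_zero_constant_ray[OF _ that])
    fix s :: real assume "0 \<le> s"
    from bounded_bilinear.has_vector_derivative[OF bounded_bilinear_inner \<zeta>(2)[OF this] \<zeta>(2)[OF this]]
    show "((\<lambda>t. \<zeta> t \<bullet> \<zeta> t) has_vector_derivative 0) (at s within {0..})"
      by (simp add: inner_commute[of "B _ _"] orth)
  qed
  have c2: "fst (\<zeta> t) \<bullet> snd (\<zeta> t) = fst (\<zeta> 0) \<bullet> snd (\<zeta> 0)" if "0 \<le> t" for t
  proof (rule has_vector_derivative_zero_constant_ray[OF _ that])
    fix s :: real assume s: "0 \<le> s"
    have "((\<lambda>t. fst (\<zeta> t) \<bullet> snd (\<zeta> t)) has_vector_derivative
        fst (\<zeta> s) \<bullet> snd (B (\<zeta> s) (\<zeta> s)) + fst (B (\<zeta> s) (\<zeta> s)) \<bullet> snd (\<zeta> s)) (at s within {0..})"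
      by (intro bounded_bilinear.has_vector_derivative[OF bounded_bilinear_inner]
          bounded_linear.has_vector_derivative[OF bounded_linear_fst]
          bounded_linear.has_vector_derivative[OF bounded_linear_snd] \<zeta>(2) s)
    then show "((\<lambda>t. fst (\<zeta> t) \<bullet> snd (\<zeta> t)) has_vector_derivative 0) (at s within {0..})"
      by (simp add: orth2)
  qed
  have "\<gamma> t \<in> Orb c1 c2" if "0 \<le> t" for t
    using c1[OF that] c2[OF that] M
    by (simp add: \<gamma>_def in_Orb_so4_mat M0 \<zeta>(1) inner_prod_def)
  then have "solution_in (Orb c1 c2) X \<gamma>"
    using d\<gamma> by (simp add: solution_in_def)
  moreover have "\<gamma> 0 = M" by (simp add: \<gamma>_def \<zeta>(1) M0)
  ultimately show thesis by (rule that)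
qed

text \<open>The orbit is a product of two spheres: \<open>x + y\<close> and \<open>x - y\<close> have prescribed norms. For a small displacement
\<open>s\<close> in the direction \<open>(1, 0, - p, - q)\<close>, the first components \<open>x\<^sub>1 + y\<^sub>1\<close> and \<open>x\<^sub>1 - y\<^sub>1\<close> are recovered as square roots.\<close>

lemma orbit_points_near_M1:
  assumes pq: "p\<^sup>2 < q\<^sup>2" and M: "M1 p q \<in> Orb c1 c2" and "0 < \<delta>"
  obtains N s where "N \<in> Orb c1 c2" "dist N (M1 p q) < \<delta>" "0 < s" "prj N = s *\<^sub>R vector [1, 0, - p, - q]"
proof -
  define \<alpha> where "\<alpha> = p + q"
  define \<beta> where "\<beta> = p - q"
  have nz: "\<alpha> \<noteq> 0" "\<beta> \<noteq> 0"
    using pq by (auto simp: \<alpha>_def \<beta>_def add_eq_0_iff2)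
  define rad where "rad e s = e\<^sup>2 - s\<^sup>2 * (1 + e\<^sup>2)" for e s :: real
  define root where "root e s = sgn e * sqrt (rad e s)" for e s :: real
  define x where "x s = (root \<alpha> s + root \<beta> s) / 2" for s
  define y where "y s = (root \<alpha> s - root \<beta> s) / 2" for s
  define N where "N s = x s *\<^sub>R M1 1 0 + y s *\<^sub>R M1 0 1 + s *\<^sub>R emb (vector [1, 0, - p, - q])" for s
  have root0: "root e 0 = e" for e
    by (simp add: root_def rad_def sgn_mult_abs)
  have N0: "N 0 = M1 p q"
    by (simp add: N_def x_def y_def root0 \<alpha>_def \<beta>_def M1_def so4_mat_scaleR so4_mat_add)
       (simp add: vec_eq_iff forall_3)
  have "(N \<longlongrightarrow> N 0) (at_right 0)"
    unfolding N_def x_def y_def root_def rad_def by (intro tendsto_intros) auto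
  then have near: "\<forall>\<^sub>F s in at_right 0. dist (N s) (N 0) < \<delta>"
    using \<open>0 < \<delta>\<close> by (rule tendstoD)
  have pos: "\<forall>\<^sub>F s in at_right 0. 0 < rad e s" if "e \<noteq> 0" for e
  proof -
    have "(rad e \<longlongrightarrow> rad e 0) (at_right 0)"
      unfolding rad_def by (intro tendsto_intros)
    moreover have "0 < rad e 0" using that by (simp add: rad_def)
    ultimately show ?thesis by (rule order_tendstoD(1))
  qed
  have "\<forall>\<^sub>F s::real in at_right 0. 0 < s" by (simp add: eventually_at_right_less)
  then have "\<forall>\<^sub>F s in at_right 0. 0 < s \<and> dist (N s) (N 0) < \<delta> \<and> 0 < rad \<alpha> s \<and> 0 < rad \<beta> s"
    using near pos[OF nz(1)] pos[OF nz(2)] by eventually_elim auto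
  then obtain s where s: "0 < s" "dist (N s) (N 0) < \<delta>" "0 < rad \<alpha> s" "0 < rad \<beta> s"
    using eventually_happens'[OF trivial_limit_at_right_real] by blast
  have root2: "(root \<alpha> s)\<^sup>2 = rad \<alpha> s" "(root \<beta> s)\<^sup>2 = rad \<beta> s"
    using s(3,4) nz by (simp_all add: root_def power_mult_distrib sgn_if)
  have Ns: "N s = so4_mat (vector [x s, s, - (s * p)]) (vector [y s, 0, - (s * q)])"
    by (simp add: N_def M1_def emb_def so4_mat_scaleR so4_mat_add)
       (simp add: vec_eq_iff forall_3)
  have sq: "(x s)\<^sup>2 + (y s)\<^sup>2 = (rad \<alpha> s + rad \<beta> s) / 2" "x s * y s = (rad \<alpha> s - rad \<beta> s) / 4"
    unfolding root2[symmetric] x_def y_def by (simp_all add: field_simps power2_eq_square)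
  have c: "p\<^sup>2 + q\<^sup>2 = 2 * c1" "p * q = c2"
    using M by (simp_all add: M1_def in_Orb_so4_mat inner_vec_def sum_3 power2_eq_square)
  have "N s \<in> Orb c1 c2"
    unfolding Ns in_Orb_so4_mat inner_vec_def sum_3 vector_3 c[symmetric] inner_real_def
    using sq unfolding rad_def \<alpha>_def \<beta>_def by (simp add: power2_eq_square) (simp add: algebra_simps)
  moreover have "prj (N s) = s *\<^sub>R vector [1, 0, - p, - q]"
    by (simp add: Ns prj_def so4_mat_nth vec_eq_iff forall_4)
  ultimately show thesis
    using that s N0 by metis
qed

section \<open>A quadratic form that grows along the flow\<close>

text \<open>The form \<open>\<xi>\<^sup>T S T \<eta>\<close> in \<open>\<xi>\<close> from \<open>u\<close> and \<open>\<eta>\<close> from \<open>v\<close>, where \<open>S = det N Id + adj(N)\<^sup>T adj(N)\<close> for \<open>N = [[g, f], [- f, h]]\<close>.\<close>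

definition lyap_form :: "real \<Rightarrow> real \<Rightarrow> real \<Rightarrow> real \<Rightarrow> real \<Rightarrow> real^4 \<Rightarrow> real^4 \<Rightarrow> real" where
  "lyap_form p q g f h u v =
     u$1 * ((h\<^sup>2 + g * h + 2 * f\<^sup>2) * (p * v$3 - q * v$4) + f * (g - h) * (q * v$3 - p * v$4))
   + u$2 * (f * (g - h) * (p * v$3 - q * v$4) + (g\<^sup>2 + g * h + 2 * f\<^sup>2) * (q * v$3 - p * v$4))"

lemma bounded_bilinear_lyap_form: "bounded_bilinear (lyap_form p q g f h)"
  by (intro bilinear_conv_bounded_bilinear[THEN iffD1])
     (auto simp: bilinear_def lyap_form_def algebra_simps intro!: linearI)

text \<open>Both identities reduce to \<open>N\<^sup>T S + S N = 2 tr N det N Id\<close>, because the linear flow satisfies \<open>T \<eta>' = - n N \<xi>\<close> and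
\<open>(q\<^sup>2 - p\<^sup>2) \<xi>' = - m N T \<eta>\<close>.\<close>

lemma lyap_form_resonant:
  fixes m n :: real
  assumes pq: "p\<^sup>2 < q\<^sup>2" and AD: "A + D = B + C"
    and g: "g = p\<^sup>2 * A - q\<^sup>2 * B" and h: "h = p\<^sup>2 * D - q\<^sup>2 * C" and f: "f = p * q * (B - A)"
  defines "L \<equiv> res_mat p q m n A B C D"
  shows "lyap_form p q g f h z (L *v z)
      = n * (A + D) * (q\<^sup>2 - p\<^sup>2) * (g * h + f\<^sup>2) * ((z$1)\<^sup>2 + (z$2)\<^sup>2)"
    and "lyap_form p q g f h (L *v z) z
      = m * (A + D) * (g * h + f\<^sup>2) * ((p * z$3 - q * z$4)\<^sup>2 + (q * z$3 - p * z$4)\<^sup>2)"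
proof -
  have tr: "g + h = - (A + D) * (q\<^sup>2 - p\<^sup>2)"
    using AD g h by algebra
  have L: "(L *v z)$1 = m * (p * A * z$3 - q * B * z$4)" "(L *v z)$2 = m * (q * C * z$3 - p * D * z$4)"
    "(L *v z)$3 = - n * (p * A * z$1 - q * C * z$2)" "(L *v z)$4 = - n * (q * B * z$1 - p * D * z$2)"
    by (simp_all add: L_def res_mat_def matrix_vector_mult_def sum_4 algebra_simps)
  have 1: "p * (L *v z)$3 - q * (L *v z)$4 = - n * (g * z$1 + f * z$2)"
     "q * (L *v z)$3 - p * (L *v z)$4 = - n * (- f * z$1 + h * z$2)"
    unfolding L using AD g h f by algebra+
  have "lyap_form p q g f h z (L *v z) = - n * (g + h) * (g * h + f\<^sup>2) * ((z$1)\<^sup>2 + (z$2)\<^sup>2)"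
    unfolding lyap_form_def 1 by algebra
  also have "\<dots> = n * (A + D) * (q\<^sup>2 - p\<^sup>2) * (g * h + f\<^sup>2) * ((z$1)\<^sup>2 + (z$2)\<^sup>2)"
    unfolding tr by algebra
  finally show "lyap_form p q g f h z (L *v z)
      = n * (A + D) * (q\<^sup>2 - p\<^sup>2) * (g * h + f\<^sup>2) * ((z$1)\<^sup>2 + (z$2)\<^sup>2)" .
  define \<theta> where "\<theta> = p * z$3 - q * z$4"
  define \<psi> where "\<psi> = q * z$3 - p * z$4"
  have 2: "(q\<^sup>2 - p\<^sup>2) * (L *v z)$1 = - m * (g * \<theta> + f * \<psi>)"
    "(q\<^sup>2 - p\<^sup>2) * (L *v z)$2 = - m * (- f * \<theta> + h * \<psi>)"
    unfolding L \<theta>_def \<psi>_def using AD g h f by algebra+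
  have "(q\<^sup>2 - p\<^sup>2) * lyap_form p q g f h (L *v z) z
    = ((q\<^sup>2 - p\<^sup>2) * (L *v z)$1) * ((h\<^sup>2 + g * h + 2 * f\<^sup>2) * \<theta> + f * (g - h) * \<psi>)
    + ((q\<^sup>2 - p\<^sup>2) * (L *v z)$2) * (f * (g - h) * \<theta> + (g\<^sup>2 + g * h + 2 * f\<^sup>2) * \<psi>)"
    unfolding lyap_form_def \<theta>_def \<psi>_def by algebra
  also have "\<dots> = - m * (g + h) * (g * h + f\<^sup>2) * (\<theta>\<^sup>2 + \<psi>\<^sup>2)"
    unfolding 2 by algebra
  also have "\<dots> = (q\<^sup>2 - p\<^sup>2) * (m * (A + D) * (g * h + f\<^sup>2) * (\<theta>\<^sup>2 + \<psi>\<^sup>2))"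
    unfolding tr by algebra
  finally show "lyap_form p q g f h (L *v z) z
      = m * (A + D) * (g * h + f\<^sup>2) * ((p * z$3 - q * z$4)\<^sup>2 + (q * z$3 - p * z$4)\<^sup>2)"
    using pq unfolding \<theta>_def \<psi>_def by simp
qed

lemma lyap_form_growth:
  assumes pq: "p\<^sup>2 < q\<^sup>2" and AD: "A + D = B + C" and pos: "0 < A" "0 < D" "0 < m" "0 < n"
    and det: "0 < g * h + f\<^sup>2"
    and g: "g = p\<^sup>2 * A - q\<^sup>2 * B" and h: "h = p\<^sup>2 * D - q\<^sup>2 * C" and f: "f = p * q * (B - A)"
  obtains k where "0 < k" "\<And>z. k * (norm z)\<^sup>2 \<le> lyap_form p q g f h (res_mat p q m n A B C D *v z) z
      + lyap_form p q g f h z (res_mat p q m n A B C D *v z)"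
proof -
  define k1 where "k1 = n * (A + D) * (q\<^sup>2 - p\<^sup>2) * (g * h + f\<^sup>2)"
  define k2 where "k2 = m * (A + D) * (g * h + f\<^sup>2)"
  \<comment> \<open>The map \<open>T\<close> does not shrink squared lengths by more than the factor \<open>k3\<close>.\<close>
  define k3 where "k3 = (\<bar>q\<bar> - \<bar>p\<bar>)\<^sup>2"
  have k: "0 < k1" "0 < k2" using pq pos det by (simp_all add: k1_def k2_def)
  have "\<bar>p\<bar> \<noteq> \<bar>q\<bar>" using pq by (metis less_irrefl power2_abs)
  then have k3: "0 < k3" by (simp add: k3_def)
  have low: "k3 * (s\<^sup>2 + t\<^sup>2) \<le> (p * s - q * t)\<^sup>2 + (q * s - p * t)\<^sup>2" for s t
  proof -
    have st: "2 * (s * t) \<le> s\<^sup>2 + t\<^sup>2" "- (2 * (s * t)) \<le> s\<^sup>2 + t\<^sup>2"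
      using zero_le_power2[of "s - t"] zero_le_power2[of "s + t"]
      by (simp_all add: power2_eq_square algebra_simps)
    have "2 * (p * q) * (2 * (s * t)) \<le> \<bar>2 * (p * q)\<bar> * \<bar>2 * (s * t)\<bar>"
      by (metis abs_ge_self abs_mult)
    also have "\<dots> \<le> \<bar>2 * (p * q)\<bar> * (s\<^sup>2 + t\<^sup>2)"
      using st by (intro mult_left_mono) auto
    finally have "4 * (p * q) * (s * t) \<le> 2 * (\<bar>p\<bar> * \<bar>q\<bar>) * (s\<^sup>2 + t\<^sup>2)"
      by (simp add: abs_mult)
    moreover have "k3 = p\<^sup>2 + q\<^sup>2 - 2 * (\<bar>p\<bar> * \<bar>q\<bar>)"
      by (simp add: k3_def power2_diff)
    then have "k3 * (s\<^sup>2 + t\<^sup>2) = (p\<^sup>2 + q\<^sup>2) * (s\<^sup>2 + t\<^sup>2) - 2 * (\<bar>p\<bar> * \<bar>q\<bar>) * (s\<^sup>2 + t\<^sup>2)"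
      by (simp only: left_diff_distrib)
    moreover have "(p * s - q * t)\<^sup>2 + (q * s - p * t)\<^sup>2
        = (p\<^sup>2 + q\<^sup>2) * (s\<^sup>2 + t\<^sup>2) - 4 * (p * q) * (s * t)"
      by algebra
    ultimately show ?thesis by linarith
  qed
  define k where "k = min k1 (k2 * k3)"
  show thesis
  proof
    show "0 < k" using k k3 by (simp add: k_def)
    fix z :: "real^4"
    have "k * (norm z)\<^sup>2 = k * ((z$1)\<^sup>2 + (z$2)\<^sup>2) + k * ((z$3)\<^sup>2 + (z$4)\<^sup>2)"
      unfolding power2_norm_eq_inner by (simp add: inner_vec_def sum_4 power2_eq_square algebra_simps)
    also have "\<dots> \<le> k1 * ((z$1)\<^sup>2 + (z$2)\<^sup>2) + (k2 * k3) * ((z$3)\<^sup>2 + (z$4)\<^sup>2)"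
      unfolding k_def by (intro add_mono mult_right_mono) auto
    also have "(k2 * k3) * ((z$3)\<^sup>2 + (z$4)\<^sup>2)
        \<le> k2 * ((p * z$3 - q * z$4)\<^sup>2 + (q * z$3 - p * z$4)\<^sup>2)"
      using low[of "z$3" "z$4"] k by (simp add: mult.assoc)
    finally show "k * (norm z)\<^sup>2 \<le> lyap_form p q g f h (res_mat p q m n A B C D *v z) z
      + lyap_form p q g f h z (res_mat p q m n A B C D *v z)"
      unfolding lyap_form_resonant[OF pq AD g h f] k1_def k2_def by simp
  qed
qed

text \<open>The components of \<open>\<xi>\<close> and \<open>\<eta>\<close> satisfy exactly the linear system with coefficients \<open>x\<^sub>1, y\<^sub>1\<close> instead of \<open>p, q\<close> (\<open>prjX\<close>
below). Linearity of \<open>res_mat\<close> in these coefficients bounds the difference to the linear flow.\<close>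

lemma resonant_unstable:
  fixes k l :: "real^3"
  assumes pq: "p\<^sup>2 < q\<^sup>2" and AD: "A + D = B + C" "A * D < B * C"
    and pos: "0 < A" "0 < B" "0 < C" "0 < D" "0 < m" "0 < n"
    and lin: "\<And>p q. lin_mat p q k l = res_mat p q m n A B C D"
    and X: "\<And>N. N \<in> so4 \<Longrightarrow> X N = lie N (diag_op k l N)"
    and S: "Orb c1 c2 \<subseteq> S" "S \<subseteq> so4" and M: "M1 p q \<in> Orb c1 c2"
  shows "unstable_in S X (M1 p q)"
proof -
  define g where "g = p\<^sup>2 * A - q\<^sup>2 * B"
  define h where "h = p\<^sup>2 * D - q\<^sup>2 * C"
  define f where "f = p * q * (B - A)"
  have "g * h + f\<^sup>2 = (q\<^sup>2 - p\<^sup>2) * (B * C * q\<^sup>2 - A * D * p\<^sup>2)"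
    using AD(1) g_def h_def f_def by algebra
  moreover have "A * D * p\<^sup>2 < B * C * q\<^sup>2"
    using pq AD(2) pos by (intro mult_strict_mono[of "A * D"]) auto
  ultimately have det: "0 < g * h + f\<^sup>2" using pq by simp
  define W where "W = lyap_form p q g f h"
  define L where "L a b = res_mat a b m n A B C D" for a b
  define R where "R a b z = W (L a b *v z) z + W z (L a b *v z)" for a b z
  obtain \<kappa> where \<kappa>: "0 < \<kappa>" "\<And>z. \<kappa> * (norm z)\<^sup>2 \<le> R p q z"
    using lyap_form_growth[OF pq AD(1) pos(1,4,5,6) det g_def h_def f_def]
    unfolding R_def W_def L_def by blast
  interpret W: bounded_bilinear W
    unfolding W_def by (rule bounded_bilinear_lyap_form)
  obtain c where c: "0 < c" "\<And>u v. norm (W u v) \<le> norm u * norm v * c"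
    using W.pos_bounded by blast
  have bound: "\<exists>d>0. \<forall>z. \<bar>R a b z\<bar> \<le> d * (norm z)\<^sup>2" for a b
  proof -
    obtain e where e: "0 < e" "\<And>z. norm (L a b *v z) \<le> norm z * e"
      using bounded_linear.pos_bounded[OF matrix_vector_mul_bounded_linear] by blast
    have "\<bar>R a b z\<bar> \<le> (2 * c * e) * (norm z)\<^sup>2" for z
    proof -
      have "\<bar>R a b z\<bar> \<le> norm (L a b *v z) * norm z * c + norm z * norm (L a b *v z) * c"
        unfolding R_def using c(2)[of "L a b *v z" z] c(2)[of z "L a b *v z"]
          abs_triangle_ineq[of "W (L a b *v z) z" "W z (L a b *v z)"] by (simp only: real_norm_def)
      also have "\<dots> = (2 * c * norm z) * norm (L a b *v z)" by simp
      also have "\<dots> \<le> (2 * c * norm z) * (norm z * e)"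
        using c e by (intro mult_left_mono) auto
      finally show ?thesis by (simp add: power2_eq_square ac_simps)
    qed
    then show ?thesis using c e by (intro exI[of _ "2 * c * e"]) simp
  qed
  obtain d1 where d1: "0 < d1" "\<And>z. \<bar>R 1 0 z\<bar> \<le> d1 * (norm z)\<^sup>2" using bound by blast
  obtain d2 where d2: "0 < d2" "\<And>z. \<bar>R 0 1 z\<bar> \<le> d2 * (norm z)\<^sup>2" using bound by blast
  obtain e where e: "0 < e" "\<And>N. norm (prj N) \<le> norm N * e"
    using bounded_linear.pos_bounded[OF bounded_linear_prj] by blast
  have split: "R a b z = R p q z + (a - p) * R 1 0 z + (b - q) * R 0 1 z" for a b z
  proof -
    have "L a b *v z = L p q *v z + (a - p) *\<^sub>R (L 1 0 *v z) + (b - q) *\<^sub>R (L 0 1 *v z)"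
      by (simp add: L_def res_mat_def vec_eq_iff forall_4 matrix_vector_mult_def sum_4 algebra_simps)
    note L_split = this
    show ?thesis
      unfolding R_def L_split W.add_left W.add_right W.scaleR_left W.scaleR_right
      by (simp add: algebra_simps)
  qed
  \<comment> \<open>Within this distance the perturbation terms consume at most half of the growth rate \<open>\<kappa>\<close>.\<close>
  define \<epsilon> where "\<epsilon> = \<kappa> / 2 / (d1 + d2)"
  have \<epsilon>: "0 < \<epsilon>" using \<kappa> d1 d2 by (simp add: \<epsilon>_def)
  have growth: "\<kappa> / 2 * (norm z)\<^sup>2 \<le> R a b z" if "\<bar>a - p\<bar> \<le> \<epsilon>" "\<bar>b - q\<bar> \<le> \<epsilon>" for a b z
  proof -
    have pert: "\<bar>(a - p) * R 1 0 z\<bar> \<le> \<epsilon> * (d1 * (norm z)\<^sup>2)" "\<bar>(b - q) * R 0 1 z\<bar> \<le> \<epsilon> * (d2 * (norm z)\<^sup>2)"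
      unfolding abs_mult using that d1 d2 by (auto intro!: mult_mono)
    have "\<epsilon> * (d1 + d2) = \<kappa> / 2"
    proof -
      have "x / y * y = x" if "y \<noteq> 0" for x y :: real using that by simp
      moreover have "d1 + d2 \<noteq> 0" using d1(1) d2(1) by simp
      ultimately show ?thesis unfolding \<epsilon>_def by blast
    qed
    moreover have "\<epsilon> * (d1 * (norm z)\<^sup>2) + \<epsilon> * (d2 * (norm z)\<^sup>2) = \<epsilon> * (d1 + d2) * (norm z)\<^sup>2"
      by (simp add: distrib_left distrib_right mult.assoc)
    ultimately have "\<epsilon> * (d1 * (norm z)\<^sup>2) + \<epsilon> * (d2 * (norm z)\<^sup>2) = \<kappa> / 2 * (norm z)\<^sup>2"
      by (simp only:)
    moreover have "\<kappa> * (norm z)\<^sup>2 = \<kappa> / 2 * (norm z)\<^sup>2 + \<kappa> / 2 * (norm z)\<^sup>2" by simp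
    ultimately show ?thesis
      unfolding split[of a b z] using \<kappa>(2)[of z] pert by linarith
  qed
  have prjX: "prj (X N) = L (N$3$2) (N$1$4) *v prj N" if "N \<in> so4" for N
    using that
  proof (cases rule: so4_cases)
    case (1 x y)
    show ?thesis
      unfolding L_def lin[symmetric] X[OF that]
      unfolding 1 diag_op_def xc_so4_mat yc_so4_mat lie_so4_mat
      by (simp add: prj_so4_mat so4_mat_nth vec_eq_iff forall_4 lin_mat_def matrix_vector_mult_def sum_4
          cross3_def algebra_simps)
  qed
  show ?thesis
  proof (rule chetaev_instability[where V = "\<lambda>N. W (prj N) (prj N)" and \<epsilon> = \<epsilon> and k = "\<kappa> / (2 * c)"
        and b = "c * (\<epsilon> * e)\<^sup>2"])
    show "0 < \<kappa> / (2 * c)" using \<kappa> c by simp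
    show "0 < \<epsilon>" by fact
  next
    fix \<gamma> t assume \<gamma>: "solution_in S X \<gamma>" and t: "0 \<le> t" and near: "dist (\<gamma> t) (M1 p q) < \<epsilon>"
    define z where "z = prj (\<gamma> t)"
    have so: "\<gamma> t \<in> so4" using \<gamma> t S unfolding solution_in_def by blast
    have d: "(\<gamma> has_vector_derivative X (\<gamma> t)) (at t within {0..})"
      using \<gamma> t by (simp add: solution_in_def)
    have "((\<lambda>t. prj (\<gamma> t)) has_vector_derivative prj (X (\<gamma> t))) (at t within {0..})"
      by (rule bounded_linear.has_vector_derivative[OF bounded_linear_prj d])
    from W.has_vector_derivative[OF this this]
    have "((\<lambda>t. W (prj (\<gamma> t)) (prj (\<gamma> t))) has_real_derivative R (\<gamma> t$3$2) (\<gamma> t$1$4) z) (at t within {0..})"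
      unfolding prjX[OF so] R_def z_def[symmetric] has_real_derivative_iff_has_vector_derivative
      by (simp add: add.commute)
    moreover have "\<kappa> / (2 * c) * W z z \<le> R (\<gamma> t$3$2) (\<gamma> t$1$4) z"
    proof -
      have comp: "\<bar>(\<gamma> t - M1 p q) $ i $ j\<bar> \<le> \<epsilon>" for i j
      proof -
        have "\<bar>(\<gamma> t - M1 p q) $ i $ j\<bar> \<le> norm ((\<gamma> t - M1 p q) $ i)"
          by (rule component_le_norm_cart)
        also have "\<dots> \<le> norm (\<gamma> t - M1 p q)"
          by (rule Finite_Cartesian_Product.norm_nth_le)
        also have "\<dots> \<le> \<epsilon>" using near by (simp add: dist_norm)
        finally show ?thesis .
      qed
      have "W z z \<le> c * (norm z)\<^sup>2"
        using c(2)[of z z] by (simp add: power2_eq_square ac_simps)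
      then have "\<kappa> / (2 * c) * W z z \<le> \<kappa> / (2 * c) * (c * (norm z)\<^sup>2)"
        using \<kappa> c by (intro mult_left_mono) auto
      also have "\<dots> = \<kappa> / 2 * (norm z)\<^sup>2" using c by simp
      also have "\<dots> \<le> R (\<gamma> t$3$2) (\<gamma> t$1$4) z"
        using comp[of 3 2] comp[of 1 4] by (intro growth) (simp_all add: M1_def so4_mat_nth)
      finally show ?thesis .
    qed
    ultimately show "\<exists>d. ((\<lambda>t. W (prj (\<gamma> t)) (prj (\<gamma> t))) has_real_derivative d) (at t within {0..})
        \<and> \<kappa> / (2 * c) * W (prj (\<gamma> t)) (prj (\<gamma> t)) \<le> d"
      unfolding z_def by blast
  next
    fix N assume N: "dist N (M1 p q) < \<epsilon>"
    have "prj (N - M1 p q) = prj N"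
      using bounded_linear.linear[OF bounded_linear_prj]
      by (simp add: linear_diff) (simp add: M1_def prj_def so4_mat_nth vec_eq_iff forall_4)
    then have "norm (prj N) \<le> dist N (M1 p q) * e"
      using e(2)[of "N - M1 p q"] by (simp add: dist_norm)
    also have "\<dots> \<le> \<epsilon> * e" using N e(1) by (intro mult_right_mono) auto
    finally have "norm (prj N) \<le> \<epsilon> * e" .
    then have "(norm (prj N))\<^sup>2 \<le> (\<epsilon> * e)\<^sup>2" by (intro power_mono) auto
    then have "c * (norm (prj N))\<^sup>2 \<le> c * (\<epsilon> * e)\<^sup>2" using c by simp
    then show "W (prj N) (prj N) \<le> c * (\<epsilon> * e)\<^sup>2"
      using c(2)[of "prj N" "prj N"] by (simp add: power2_eq_square ac_simps)
  next
    fix \<delta> :: real assume "0 < \<delta>"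
    then obtain N s where N: "N \<in> Orb c1 c2" "dist N (M1 p q) < \<delta>" "0 < s"
      "prj N = s *\<^sub>R vector [1, 0, - p, - q]"
      using orbit_points_near_M1[OF pq M] by metis
    obtain \<gamma> where \<gamma>: "solution_in (Orb c1 c2) X \<gamma>" "\<gamma> 0 = N"
      using rigid_flow_exists[OF X N(1)] by blast
    have "W (prj N) (prj N) = s\<^sup>2 * ((h\<^sup>2 + f\<^sup>2 + (g * h + f\<^sup>2)) * (q\<^sup>2 - p\<^sup>2))"
      unfolding W_def lyap_form_def N(4) by (simp add: power2_eq_square algebra_simps)
    moreover have "0 < h\<^sup>2 + f\<^sup>2 + (g * h + f\<^sup>2)"
      using det by (intro add_nonneg_pos[of "h\<^sup>2 + f\<^sup>2"]) auto
    ultimately have "0 < W (prj N) (prj N)" using N(3) pq by simp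
    moreover have "solution_in S X \<gamma>" using \<gamma>(1) S by (auto simp: solution_in_def)
    ultimately show "\<exists>\<gamma>. solution_in S X \<gamma> \<and> dist (\<gamma> 0) (M1 p q) < \<delta> \<and> 0 < W (prj (\<gamma> 0)) (prj (\<gamma> 0))"
      using \<gamma>(2) N(2) by auto
  qed
qed

section \<open>Consequences of the resonance\<close>

text \<open>The resonance gives two factorizations of each of \<open>m\<close> and \<open>n\<close>. They turn the eight differences of reciprocals that
occur in the linearization of \<open>H\<close> into multiples of \<open>m\<close> or \<open>n\<close> with only four coefficients. The last identity says that \<open>(B - C) / (D - A)\<close> is the square root of the
smaller root of \<open>f_tilde\<close>.\<close>

theorem resonance_ratio:
  fixes a b c d :: real
  assumes order: "a > b" "b > c" "c > d"
    and pos: "0 < a + b" "0 < a + c" "0 < a + d" "0 < b + c" "0 < b + d" "0 < c + d"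
    and res: "a\<^sup>2 + d\<^sup>2 = b\<^sup>2 + c\<^sup>2"
  defines "A \<equiv> 1 / ((b + c) * (a + b) * (a + c))" and "B \<equiv> 1 / ((a + d) * (c + d) * (a + c))"
    and "C \<equiv> 1 / ((a + d) * (a + b) * (b + d))" and "D \<equiv> 1 / ((b + c) * (c + d) * (b + d))"
    and "m \<equiv> a\<^sup>2 - c\<^sup>2" and "n \<equiv> a\<^sup>2 - b\<^sup>2"
  shows "0 < A" "0 < B" "0 < C" "0 < D" "0 < m" "0 < n"
    and "1 / (b + c) - 1 / (a + b) = m * A" "1 / (b + c) - 1 / (a + c) = n * A"
    and "1 / (c + d) - 1 / (a + d) = m * B" "1 / (a + d) - 1 / (a + c) = n * B"
    and "1 / (a + d) - 1 / (a + b) = m * C" "1 / (b + d) - 1 / (a + d) = n * C"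
    and "1 / (c + d) - 1 / (b + c) = m * D" "1 / (b + d) - 1 / (b + c) = n * D"
    and "A + D = B + C" "A * D < B * C" "A < B" "A < D"
    and "(B - C) * (a\<^sup>2 - d\<^sup>2) = (D - A) * (b\<^sup>2 - c\<^sup>2)"
proof -
  show AD0: "0 < A" "0 < B" "0 < C" "0 < D"
    using pos by (simp_all add: A_def B_def C_def D_def)
  have m: "m = (a - c) * (a + c)" "m = (b - d) * (b + d)"
    using res by (simp_all add: m_def power2_eq_square algebra_simps)
  have n: "n = (a - b) * (a + b)" "n = (c - d) * (c + d)"
    using res by (simp_all add: n_def power2_eq_square algebra_simps)
  show mn: "0 < m" "0 < n" using order pos by (simp_all add: m(1) n(1))
  have nz: "a + b \<noteq> 0" "a + c \<noteq> 0" "a + d \<noteq> 0" "b + c \<noteq> 0" "b + d \<noteq> 0" "c + d \<noteq> 0"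
    using pos by auto
  have diff: "1 / y - 1 / x = (x - y) / (x * y)" if "x \<noteq> 0" "y \<noteq> 0" for x y :: real
    using that by (simp add: field_simps)
  show mA: "1 / (b + c) - 1 / (a + b) = m * A" and "1 / (b + c) - 1 / (a + c) = n * A"
    unfolding A_def diff[OF nz(1,4)] diff[OF nz(2,4)] m(1) n(1) using nz by simp_all
  show mB: "1 / (c + d) - 1 / (a + d) = m * B" and "1 / (a + d) - 1 / (a + c) = n * B"
    unfolding B_def diff[OF nz(3,6)] diff[OF nz(2,3)] m(1) n(2) using nz by simp_all
  show mC: "1 / (a + d) - 1 / (a + b) = m * C" and "1 / (b + d) - 1 / (a + d) = n * C"
    unfolding C_def diff[OF nz(1,3)] diff[OF nz(3,5)] m(2) n(1) using nz by simp_all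
  show mD: "1 / (c + d) - 1 / (b + c) = m * D" and "1 / (b + d) - 1 / (b + c) = n * D"
    unfolding D_def diff[OF nz(4,6)] diff[OF nz(4,5)] m(2) n(2) using nz by simp_all
  have "m * (A + D) = m * (B + C)"
    unfolding distrib_left mA[symmetric] mB[symmetric] mC[symmetric] mD[symmetric] by simp
  then show sum: "A + D = B + C" using mn by simp
  \<comment> \<open>Sums of squares being equal, the pair with the larger difference has the smaller sum.\<close>
  have "(b - c)\<^sup>2 < (a - d)\<^sup>2"
    using order by (intro power_strict_mono) auto
  moreover have "(a + d)\<^sup>2 + (a - d)\<^sup>2 = (b + c)\<^sup>2 + (b - c)\<^sup>2"
    using res by (simp add: power2_eq_square algebra_simps)
  ultimately have "(a + d)\<^sup>2 < (b + c)\<^sup>2" by linarith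
  then have lt: "a + d < b + c" using pos by (simp add: power_less_imp_less_base)
  define e where "e = (a + b) * (c + d) * ((a + c) * (b + d))"
  have e: "0 < e" using pos by (simp add: e_def)
  have "A * D = 1 / ((b + c)\<^sup>2 * e)" "B * C = 1 / ((a + d)\<^sup>2 * e)"
    by (simp_all add: A_def B_def C_def D_def e_def power2_eq_square ac_simps)
  then show "A * D < B * C"
    using \<open>(a + d)\<^sup>2 < (b + c)\<^sup>2\<close> e pos
    by (simp add: frac_less2)
  have "(a + d) * (c + d) < (b + c) * (a + b)"
    using lt order pos by (intro mult_strict_mono) auto
  then show "A < B"
    unfolding A_def B_def using pos by (intro divide_strict_left_mono) auto
  have "(c + d) * (b + d) < (a + b) * (a + c)"
    using order pos by (intro mult_strict_mono) auto
  then show "A < D"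
    unfolding A_def D_def using pos
    by (intro divide_strict_left_mono) (auto simp: mult.assoc)
  have A1: "A * ((b + c) * (a + b) * (a + c)) = 1" and B1: "B * ((a + d) * (c + d) * (a + c)) = 1"
    and C1: "C * ((a + d) * (a + b) * (b + d)) = 1" and D1: "D * ((b + c) * (c + d) * (b + d)) = 1"
    using nz by (simp_all add: A_def B_def C_def D_def)
  have E: "(B - C) * ((a + d) * ((a + b) * (c + d) * (a + c) * (b + d))) = (a + b) * (b + d) - (c + d) * (a + c)"
    "(D - A) * ((b + c) * ((a + b) * (c + d) * (a + c) * (b + d))) = (a + b) * (a + c) - (c + d) * (b + d)"
    using A1 B1 C1 D1 by algebra+
  define k where "k = (a + b) * (c + d) * (a + c) * (b + d)"
  have "k \<noteq> 0" using nz by (simp add: k_def)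
  have "k * ((B - C) * (a\<^sup>2 - d\<^sup>2)) = (a - d) * ((B - C) * ((a + d) * k))"
    by algebra
  also have "\<dots> = (a - d) * ((b - c) * (a + b + c + d))"
    unfolding k_def E(1) by algebra
  also have "\<dots> = (b - c) * ((D - A) * ((b + c) * k))"
    unfolding k_def E(2) by algebra
  also have "\<dots> = k * ((D - A) * (b\<^sup>2 - c\<^sup>2))" by algebra
  finally show "(B - C) * (a\<^sup>2 - d\<^sup>2) = (D - A) * (b\<^sup>2 - c\<^sup>2)"
    using \<open>k \<noteq> 0\<close> by simp
qed

lemma f_tilde_factor:
  assumes "(lam$1)\<^sup>2 + (lam$4)\<^sup>2 = (lam$2)\<^sup>2 + (lam$3)\<^sup>2"
  shows "f_tilde lam t = (t - 1) * (((lam$1)\<^sup>2 - (lam$4)\<^sup>2)\<^sup>2 * t - ((lam$2)\<^sup>2 - (lam$3)\<^sup>2)\<^sup>2)"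
  unfolding f_tilde_def using assms by algebra

lemma f_tilde_roots:
  assumes order: "lam$1 > lam$2" "lam$2 > lam$3" "lam$3 > lam$4"
    and pos: "\<And>i j. i \<noteq> j \<Longrightarrow> lam$i + lam$j > 0"
    and res: "(lam$1)\<^sup>2 + (lam$4)\<^sup>2 = (lam$2)\<^sup>2 + (lam$3)\<^sup>2"
  shows "{t. f_tilde lam t = 0} = {alpha1 lam, 1}"
    "alpha1 lam * ((lam$1)\<^sup>2 - (lam$4)\<^sup>2)\<^sup>2 = ((lam$2)\<^sup>2 - (lam$3)\<^sup>2)\<^sup>2" "0 < alpha1 lam" "alpha1 lam < 1"
proof -
  define S where "S = (lam$1)\<^sup>2 - (lam$4)\<^sup>2"
  define R where "R = (lam$2)\<^sup>2 - (lam$3)\<^sup>2"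
  have R: "R = (lam$2 - lam$3) * (lam$2 + lam$3)"
    unfolding R_def by algebra
  have n: "S - R = 2 * ((lam$3 - lam$4) * (lam$3 + lam$4))"
    unfolding R_def S_def using res by algebra
  have "0 < R" using order pos[of 2 3] by (simp add: R)
  moreover have "0 < S - R" using order pos[of 3 4] by (simp add: n)
  ultimately have RS: "0 < R" "R < S" by auto
  then have sq: "0 < R\<^sup>2" "R\<^sup>2 < S\<^sup>2" by (auto intro: power_strict_mono)
  have root: "f_tilde lam t = 0 \<longleftrightarrow> t = 1 \<or> t = R\<^sup>2 / S\<^sup>2" for t
    using RS unfolding f_tilde_factor[OF res] S_def[symmetric] R_def[symmetric] by (auto simp: eq_divide_eq mult.commute)
  then have roots: "{t. f_tilde lam t = 0} = {R\<^sup>2 / S\<^sup>2, 1}" by auto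
  have lt: "R\<^sup>2 / S\<^sup>2 < 1" using sq RS by (simp add: divide_less_eq_1_pos)
  have alpha: "alpha1 lam = R\<^sup>2 / S\<^sup>2"
    unfolding alpha1_def roots using lt by simp
  show "{t. f_tilde lam t = 0} = {alpha1 lam, 1}" "0 < alpha1 lam" "alpha1 lam < 1"
    using roots lt sq RS by (simp_all add: alpha)
  show "alpha1 lam * ((lam$1)\<^sup>2 - (lam$4)\<^sup>2)\<^sup>2 = ((lam$2)\<^sup>2 - (lam$3)\<^sup>2)\<^sup>2"
    unfolding alpha S_def[symmetric] R_def[symmetric] using RS by simp
qed

text \<open>With \<open>u = D - A\<close> and \<open>v = B - C\<close> one has \<open>g - h = - (u p\<^sup>2 + v q\<^sup>2)\<close> and \<open>2 f = p q (u + v)\<close>, so the left-hand side is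
\<open>(q\<^sup>2 - p\<^sup>2) (v\<^sup>2 q\<^sup>2 - u\<^sup>2 p\<^sup>2)\<close>.\<close>

lemma resonant_discriminant:
  fixes p q A B C D S R \<alpha> :: real
  assumes AD: "A + D = B + C" and ratio: "(B - C) * S = (D - A) * R" and alpha: "\<alpha> * S\<^sup>2 = R\<^sup>2" and "S \<noteq> 0"
  shows "((p\<^sup>2 * A - q\<^sup>2 * B) - (p\<^sup>2 * D - q\<^sup>2 * C))\<^sup>2 - 4 * (p * q * (B - A))\<^sup>2
    = (q\<^sup>2 - p\<^sup>2) * (D - A)\<^sup>2 * (\<alpha> * q\<^sup>2 - p\<^sup>2)"
proof -
  have "(B - C)\<^sup>2 * S\<^sup>2 = ((D - A)\<^sup>2 * \<alpha>) * S\<^sup>2"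
    using ratio alpha by algebra
  then have "(B - C)\<^sup>2 = (D - A)\<^sup>2 * \<alpha>" using \<open>S \<noteq> 0\<close> by simp
  then show ?thesis using AD by algebra
qed

section \<open>The rigid body\<close>

text \<open>The entries are the quotients \<open>\<Omega>\<^sub>i\<^sub>j / M\<^sub>i\<^sub>j = 1 / (\<lambda>\<^sub>i + \<lambda>\<^sub>j)\<close>, listed as the coefficients of \<open>x\<close>.\<close>

definition inertia_x :: "real^4 \<Rightarrow> real^3" where
  "inertia_x lam = vector [1 / (lam$2 + lam$3), 1 / (lam$1 + lam$3), 1 / (lam$1 + lam$2)]"

definition inertia_y :: "real^4 \<Rightarrow> real^3" where
  "inertia_y lam = vector [1 / (lam$1 + lam$4), 1 / (lam$2 + lam$4), 1 / (lam$3 + lam$4)]"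

text \<open>Twice the coefficients of \<open>I\<close>, since \<open>diag_energy\<close> carries the factor one half.\<close>

definition integral_x :: "real^4 \<Rightarrow> real^3" where
  "integral_x lam = vector [2 * ((lam$2)\<^sup>2 + (lam$3)\<^sup>2), 2 * ((lam$1)\<^sup>2 + (lam$3)\<^sup>2), 2 * ((lam$1)\<^sup>2 + (lam$2)\<^sup>2)]"

definition integral_y :: "real^4 \<Rightarrow> real^3" where
  "integral_y lam = vector [2 * ((lam$1)\<^sup>2 + (lam$4)\<^sup>2), 2 * ((lam$2)\<^sup>2 + (lam$4)\<^sup>2), 2 * ((lam$3)\<^sup>2 + (lam$4)\<^sup>2)]"

lemma H_fun_diag_energy: "H_fun lam = diag_energy (inertia_x lam) (inertia_y lam)"
  by (rule ext) (simp add: H_fun_def diag_energy_def inertia_x_def inertia_y_def inner_vec_def sum_3 power2_eq_square)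

lemma I_fun_diag_energy: "I_fun lam = diag_energy (integral_x lam) (integral_y lam)"
  by (rule ext) (simp add: I_fun_def diag_energy_def integral_x_def integral_y_def inner_vec_def sum_3
      power2_eq_square algebra_simps)

lemma Omega_diag_op:
  assumes pos: "\<And>i j. i \<noteq> j \<Longrightarrow> lam$i + lam$j > 0" and "M \<in> so4"
  shows "Omega lam M = diag_op (inertia_x lam) (inertia_y lam) M"
  unfolding Omega_def
proof (rule the_equality)
  have comp: "(J_mat lam ** W + W ** J_mat lam) $ i $ j = (lam$i + lam$j) * W$i$j" for W i j
    by (simp add: J_mat_def matrix_matrix_mult_def if_distrib if_distribR sum.delta sum.delta'
        algebra_simps cong: if_cong)
  have nz: "lam$i + lam$j \<noteq> 0" if "i \<noteq> j" for i j
    using pos[OF that] by simp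
  obtain x y where M: "M = so4_mat x y" using \<open>M \<in> so4\<close> by (rule so4_cases)
  have "M = J_mat lam ** diag_op (inertia_x lam) (inertia_y lam) M + diag_op (inertia_x lam) (inertia_y lam) M ** J_mat lam"
    using nz[of 1 2] nz[of 1 3] nz[of 1 4] nz[of 2 3] nz[of 2 4] nz[of 3 4]
    unfolding mat4_eq_iff comp
    by (simp add: M forall_4 diag_op_def xc_so4_mat yc_so4_mat so4_mat_nth inertia_x_def inertia_y_def add.commute)
  then show "diag_op (inertia_x lam) (inertia_y lam) M \<in> so4 \<and> M = J_mat lam ** diag_op (inertia_x lam) (inertia_y lam) M
      + diag_op (inertia_x lam) (inertia_y lam) M ** J_mat lam"
    by (simp add: diag_op_def)
  note eq = this
  fix W assume W: "W \<in> so4 \<and> M = J_mat lam ** W + W ** J_mat lam"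
  have skew: "V $ i $ i = 0" if "V \<in> so4" for V i
  proof -
    have "transpose V $ i $ i = (- V) $ i $ i" using that by (simp add: so4_def)
    then show ?thesis by (simp add: transpose_def)
  qed
  have "W $ i $ j = diag_op (inertia_x lam) (inertia_y lam) M $ i $ j" for i j
  proof (cases "i = j")
    case True
    then show ?thesis using skew W eq by simp
  next
    case False
    have "(lam$i + lam$j) * W$i$j = (lam$i + lam$j) * diag_op (inertia_x lam) (inertia_y lam) M $ i $ j"
      using W eq by (metis comp)
    then show ?thesis using nz[OF False] by simp
  qed
  then show "W = diag_op (inertia_x lam) (inertia_y lam) M" by (simp add: vec_eq_iff)
qed

text \<open>The classification for any \<open>p\<^sup>2 < q\<^sup>2\<close>; both equilibria of the orbit are of this form with the same ratio \<open>p\<^sup>2 / q\<^sup>2\<close>.\<close>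

theorem equilibrium_type:
  fixes lam :: "real^4" and p q c1 c2 :: real
  assumes order: "lam$1 > lam$2" "lam$2 > lam$3" "lam$3 > lam$4"
    and pos: "\<And>i j. i \<noteq> j \<Longrightarrow> lam$i + lam$j > 0"
    and res: "(lam$1)\<^sup>2 + (lam$4)\<^sup>2 = (lam$2)\<^sup>2 + (lam$3)\<^sup>2"
    and pq: "p\<^sup>2 < q\<^sup>2" and M: "M1 p q \<in> Orb c1 c2"
  shows "rigid_body lam (M1 p q) = 0"
    "p\<^sup>2 / q\<^sup>2 < alpha1 lam \<Longrightarrow> nondegenerate lam c1 c2 (M1 p q) \<and> saddle_saddle lam c1 c2 (M1 p q)"
    "alpha1 lam < p\<^sup>2 / q\<^sup>2 \<Longrightarrow> nondegenerate lam c1 c2 (M1 p q) \<and> focus_focus lam c1 c2 (M1 p q)"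
    "p\<^sup>2 / q\<^sup>2 = alpha1 lam \<Longrightarrow> degenerate lam c1 c2 (M1 p q)"
    "unstable_in (Orb c1 c2) (rigid_body lam) (M1 p q)" "unstable_in so4 (rigid_body lam) (M1 p q)"
proof -
  define A where "A = 1 / ((lam$2 + lam$3) * (lam$1 + lam$2) * (lam$1 + lam$3))"
  define B where "B = 1 / ((lam$1 + lam$4) * (lam$3 + lam$4) * (lam$1 + lam$3))"
  define C where "C = 1 / ((lam$1 + lam$4) * (lam$1 + lam$2) * (lam$2 + lam$4))"
  define D where "D = 1 / ((lam$2 + lam$3) * (lam$3 + lam$4) * (lam$2 + lam$4))"
  define m where "m = (lam$1)\<^sup>2 - (lam$3)\<^sup>2"
  define n where "n = (lam$1)\<^sup>2 - (lam$2)\<^sup>2"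
  have pos': "0 < lam$1 + lam$2" "0 < lam$1 + lam$3" "0 < lam$1 + lam$4" "0 < lam$2 + lam$3"
    "0 < lam$2 + lam$4" "0 < lam$3 + lam$4"
    by (rule pos, simp)+
  note ratio = resonance_ratio[OF order pos' res, folded A_def B_def C_def D_def m_def n_def]
  have neq: "p\<^sup>2 \<noteq> q\<^sup>2" and q0: "0 < q\<^sup>2"
    using pq zero_le_power2[of p] by linarith+
  have linH: "lin_mat p q (inertia_x lam) (inertia_y lam) = res_mat p q m n A B C D" for p q
  proof -
    have "m * (p * A) = p * (m * A)" "m * (q * B) = q * (m * B)" "m * (q * C) = q * (m * C)" "m * (p * D) = p * (m * D)"
      "n * (p * A) = p * (n * A)" "n * (q * B) = q * (n * B)" "n * (q * C) = q * (n * C)" "n * (p * D) = p * (n * D)"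
      by simp_all
    then show ?thesis
      by (simp add: lin_mat_def res_mat_def inertia_x_def inertia_y_def ratio(7-14)[symmetric]
          right_diff_distrib)
  qed
  have linI: "lin_mat p q (integral_x lam) (integral_y lam) = res_mat p q m n (- 2) (- 2) (- 2) (- 2)"
  proof -
    have d: "(lam$4)\<^sup>2 = (lam$2)\<^sup>2 + (lam$3)\<^sup>2 - (lam$1)\<^sup>2" using res by simp
    show ?thesis
      unfolding mat4_eq_iff forall_4 lin_mat_def res_mat_def integral_x_def integral_y_def m_def n_def
        vector_4_nth vector_3 d
      by (simp add: algebra_simps)
  qed
  have rigid: "rigid_body lam N = lie N (diag_op (inertia_x lam) (inertia_y lam) N)" if "N \<in> so4" for N
    by (simp add: rigid_body_def Omega_diag_op[OF pos that])
  show equi: "rigid_body lam (M1 p q) = 0"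
    unfolding rigid[OF M1_in_so4] unfolding M1_def diag_op_def xc_so4_mat yc_so4_mat lie_so4_mat so4_mat_zero[symmetric]
      so4_mat_eq_iff
    by (simp add: vec_eq_iff forall_3 cross3_def)
  have sing: "singular_equilibrium lam c1 c2 (M1 p q)"
    unfolding singular_equilibrium_def H_fun_diag_energy I_fun_diag_energy
    using M equi critical_diag_energy_M1[OF neq] by blast
  show "unstable_in (Orb c1 c2) (rigid_body lam) (M1 p q)" "unstable_in so4 (rigid_body lam) (M1 p q)"
    by (rule resonant_unstable[OF pq ratio(15,16) ratio(1-6) linH rigid _ _ M]; auto simp: Orb_def)+
  define g where "g = p\<^sup>2 * A - q\<^sup>2 * B"
  define h where "h = p\<^sup>2 * D - q\<^sup>2 * C"
  define f where "f = p * q * (B - A)"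
  have L: "lin_algebra lam (M1 p q) = lie_generated (sp_orb (M1 p q))
      {lift_mat (res_mat p q m n A B C D), lift_mat (res_mat p q m n (- 2) (- 2) (- 2) (- 2))}"
    unfolding lin_algebra_def H_fun_diag_energy I_fun_diag_energy linearization_diag_energy[OF neq] linH linI ..
  note type = resonant_type[OF ratio(5,6) pq ratio(15) g_def h_def f_def L]
  have S: "(lam$1)\<^sup>2 - (lam$4)\<^sup>2 \<noteq> 0"
  proof -
    have "(lam$1)\<^sup>2 - (lam$4)\<^sup>2 = (lam$1 - lam$4) * (lam$1 + lam$4)" by algebra
    then show ?thesis using order pos' by simp
  qed
  note roots = f_tilde_roots[OF order pos res]
  have disc: "(g - h)\<^sup>2 - 4 * f\<^sup>2 = (q\<^sup>2 - p\<^sup>2) * (D - A)\<^sup>2 * (alpha1 lam * q\<^sup>2 - p\<^sup>2)"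
    unfolding g_def h_def f_def by (rule resonant_discriminant[OF ratio(15,19) roots(2) S])
  have k: "0 < (q\<^sup>2 - p\<^sup>2) * (D - A)\<^sup>2" using pq ratio(18) by simp
  show "nondegenerate lam c1 c2 (M1 p q) \<and> saddle_saddle lam c1 c2 (M1 p q)" if "p\<^sup>2 / q\<^sup>2 < alpha1 lam"
  proof -
    have "0 < alpha1 lam * q\<^sup>2 - p\<^sup>2" using that q0 by (simp add: divide_less_eq)
    then have "4 * f\<^sup>2 < (g - h)\<^sup>2" using disc k by (smt (verit) mult_pos_pos)
    then show ?thesis
      using type(1) sing unfolding saddle_saddle_def nondegenerate_def by blast
  qed
  show "nondegenerate lam c1 c2 (M1 p q) \<and> focus_focus lam c1 c2 (M1 p q)" if "alpha1 lam < p\<^sup>2 / q\<^sup>2"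
  proof -
    have "alpha1 lam * q\<^sup>2 - p\<^sup>2 < 0" using that q0 by (simp add: less_divide_eq)
    then have "(g - h)\<^sup>2 < 4 * f\<^sup>2" using disc k by (smt (verit) mult_pos_neg)
    then show ?thesis
      using type(2) sing unfolding focus_focus_def nondegenerate_def by blast
  qed
  show "degenerate lam c1 c2 (M1 p q)" if "p\<^sup>2 / q\<^sup>2 = alpha1 lam"
  proof -
    have "p\<^sup>2 = alpha1 lam * q\<^sup>2" using that q0 by (simp add: field_simps)
    then have "(g - h)\<^sup>2 = 4 * f\<^sup>2" using disc by simp
    moreover have "p \<noteq> 0" "q \<noteq> 0" using that q0 roots(3) by auto
    then have "f \<noteq> 0" using ratio(17) by (simp add: f_def)
    ultimately show ?thesis
      using type(3) sing unfolding degenerate_def by blast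
  qed
qed

theorem theorem5p4:
  fixes lam :: "real^4" and c1 c2 a b :: real
  assumes order: "lam$1 > lam$2" "lam$2 > lam$3" "lam$3 > lam$4"
    and pos: "\<And>i j. i \<noteq> j \<Longrightarrow> lam$i + lam$j > 0"
    and resonance: "(lam$1)\<^sup>2 + (lam$4)\<^sup>2 = (lam$2)\<^sup>2 + (lam$3)\<^sup>2"
    and c: "c1 > \<bar>c2\<bar>"
    and a: "a = 1 / sqrt 2 * (sqrt (c1 + c2) + sqrt (c1 - c2))"
    and b: "b = 1 / sqrt 2 * (sqrt (c1 + c2) - sqrt (c1 - c2))"
  shows "{t. f_tilde lam t = 0} = {alpha1 lam, 1} \<and> 0 < alpha1 lam \<and> alpha1 lam < 1 \<and>
    (\<forall>M \<in> {M1 b a, M1 (- b) (- a)}.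
       M \<in> t1 \<inter> Orb c1 c2 \<and> rigid_body lam M = 0 \<and>
       (b\<^sup>2 / a\<^sup>2 \<in> {0..<alpha1 lam} \<longrightarrow>
          nondegenerate lam c1 c2 M \<and>
          unstable_in (Orb c1 c2) (rigid_body lam) M \<and>
          saddle_saddle lam c1 c2 M) \<and>
       (b\<^sup>2 / a\<^sup>2 \<in> {alpha1 lam<..<1} \<longrightarrow>
          nondegenerate lam c1 c2 M \<and>
          unstable_in (Orb c1 c2) (rigid_body lam) M \<and>
          focus_focus lam c1 c2 M) \<and>
       (b\<^sup>2 / a\<^sup>2 = alpha1 lam \<longrightarrow>
          degenerate lam c1 c2 M \<and>
          unstable_in (Orb c1 c2) (rigid_body lam) M) \<and>
       unstable_in so4 (rigid_body lam) M)"
proof -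
  define r where "r = sqrt (c1 + c2)"
  define s where "s = sqrt (c1 - c2)"
  have rs: "0 < r" "0 < s" "r\<^sup>2 = c1 + c2" "s\<^sup>2 = c1 - c2"
    using c by (auto simp: r_def s_def)
  have half: "(1 / sqrt 2)\<^sup>2 = 1 / (2 :: real)" by (simp add: power_divide)
  have ab: "2 * a\<^sup>2 = (r + s)\<^sup>2" "2 * b\<^sup>2 = (r - s)\<^sup>2" "2 * (a * b) = r\<^sup>2 - s\<^sup>2"
    unfolding a b r_def[symmetric] s_def[symmetric] using half by algebra+
  have "(r + s)\<^sup>2 - (r - s)\<^sup>2 = 4 * (r * s)" by algebra
  moreover have "0 < r * s" using rs by simp
  ultimately have lt: "b\<^sup>2 < a\<^sup>2" using ab by linarith
  have "2 * (a\<^sup>2 + b\<^sup>2) = 2 * (2 * c1)" "2 * (a * b) = 2 * c2" using ab rs(3,4) by algebra+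
  then have c1: "b\<^sup>2 + a\<^sup>2 = 2 * c1" and c2: "b * a = c2" by (simp_all add: mult.commute)
  have orb: "M1 b a \<in> Orb c1 c2" "M1 (- b) (- a) \<in> Orb c1 c2"
    using c1 c2 by (simp_all add: M1_def in_Orb_so4_mat inner_vec_def sum_3 power2_eq_square)
  have lt': "(- b)\<^sup>2 < (- a)\<^sup>2" using lt by simp
  have t1: "M1 p q \<in> t1" for p q by (auto simp: t1_def)
  note roots = f_tilde_roots[OF order pos resonance]
  note plus = equilibrium_type[OF order pos resonance lt orb(1)]
  note minus = equilibrium_type[OF order pos resonance lt' orb(2), simplified power2_minus]
  show ?thesis
    using roots(1,3,4) orb t1 plus minus by auto
qed

end
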